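(* Let $a_1 \ge 2, a_2, \dots, a_s, q, n, r, t$ be positive integers. Run the following procedure (Algorithm B) with inputs $\mathcal{A}_1 = \mathcal{H}^t_{max}(a_1 - 1, a_2, \dots, a_s; q; n - r)$ and $\mathcal{A}_2 = \mathcal{H}^t_{max}(a_1 - 1, a_2, \dots, a_s; q - 1; n - 1)$, starting with $\mathcal{B} = \emptyset$: 1. Let $\mathcal{A}_1'$ be the set of all graphs $H \in \mathcal{H}^t_{+K_{q-1}}(a_1 - 1, a_2, \dots, a_s; q; n - r)$ that have no cone vertices (these can be obtained by removing edges from graphs in $\mathcal{A}_1$). 2. For each $H \in \mathcal{A}_1'$: (2.1) find the family $\mathcal{M}(H) = \{M_1,\dots,M_l\}$ of all maximal (under inclusion) subsets of $V(H)$ inducing a $K_{q-1}$-free subgraph; (2.2) find all $r$-element multisets $N = \{M_{i_1},\dots,M_{i_r}\}$ of elements of $\mathcal{M}(H)$ such that (a) for any two members $M_{i_j}, M_{i_k}$ of $N$, the subgraph of $H$ induced by $M_{i_j} \cap M_{i_k}$ contains a $K_{q-2}$, and (b) $\alpha\big(H - \bigcup_{M \in N'} M\big) \le t - |N'|$ for every sub-multiset $N'$ of $N$; (2.3) for each such $N$, construct $G = G(N)$ by adding to $H$ new pairwise non-adjacent vertices $v_1,\dots,v_r$ with $N_G(v_j) = M_{i_j}$, $j = 1,\dots,r$; if $\omega(G+e) = q$ for every edge $e$ of the complement of $G$, add $G$ to $\mathcal{B}$. 3. Remove isomorphic copies from $\mathcal{B}$. 4. Remove from $\mathcal{B}$ all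 graphs $G$ with $G \not\overset{v}{\rightarrow} (a_1, \dots, a_s)$. 5. If $t > r$: let $\mathcal{A}_1''$ be the set of graphs in $\mathcal{A}_1$ with exactly one cone vertex; for each such graph, written as $K_1 + H$, if $K_1 + H \overset{v}{\rightarrow} (a_1,\dots,a_s)$, add $\overline{K}_{r+1} + H$ to $\mathcal{B}$. 6. For each $H \in \mathcal{A}_2$ with $\alpha(H) \ge r$, if $K_1 + H \overset{v}{\rightarrow} (a_1,\dots,a_s)$, add $K_1 + H$ to $\mathcal{B}$. Then after the execution of this procedure, the set $\mathcal{B}$ coincides with the set of all graphs $G \in \mathcal{H}^t_{max}(a_1, \dots, a_s; q; n)$ with $\alpha(G) \ge r$.
   Context: All graphs are finite, simple and undirected; $\omega(G)$ is the clique number and $\alpha(G)$ the independence number; $N_G(v)$ is the neighbourhood of $v$. $G_1 + G_2$ denotes the join (disjoint union plus all edges between $G_1$ and $G_2$); $\overline{K}_k$ is the edgeless graph on $k$ vertices. A cone vertex is a vertex adjacent to all other vertices. $G \overset{v}{\rightarrow} (a_1, \dots, a_s)$ means that for every coloring of $V(G)$ in $s$ colors there is $i$ with a monochromatic $a_i$-clique of color $i$. $\mathcal{H}(a_1,\dots,a_s;q;n)$ is the set of $n$-vertex graphs $G$ with $G \overset{v}{\rightarrow} (a_1,\dots,a_s)$ and $\omega(G) < q$. A graph $G$ is a $(+K_k)$-graph if for every edge $e$ of the complement of $G$, $G + e$ contains a new $k$-clique. $\mathcal{H}_{+K_k}(a_1,\dots,a_s;q;n)$ is the set of $(+K_k)$-graphs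 in $\mathcal{H}(a_1,\dots,a_s;q;n)$, and $\mathcal{H}_{max}(a_1,\dots,a_s;q;n) = \mathcal{H}_{+K_q}(a_1,\dots,a_s;q;n)$ is the set of maximal $K_q$-free graphs in it. The superscript $t$, as in $\mathcal{H}^t_{max}$ and $\mathcal{H}^t_{+K_k}$, denotes the subset of graphs with independence number at most $t$. *)

theory Defs
  imports Main "HOL-Library.Ramsey" "HOL-Library.Multiset"
begin

section \<open>Finite simple graphs\<close>

type_synonym 'v graph = "'v set \<times> 'v set set"

abbreviation verts :: "'v graph \<Rightarrow> 'v set" where "verts \<equiv> fst"
abbreviation edges :: "'v graph \<Rightarrow> 'v set set" where "edges \<equiv> snd"

definition simple_graph :: "'v graph \<Rightarrow> bool" where
  "simple_graph G \<longleftrightarrow> finite (verts G) \<and> edges G \<subseteq> [verts G]\<^bsup>2\<^esup>"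

definition graph_iso :: "'v graph \<Rightarrow> 'w graph \<Rightarrow> bool" (infix \<open>\<cong>\<^sub>G\<close> 50) where
  "G \<cong>\<^sub>G H \<longleftrightarrow> simple_graph G \<and> simple_graph H \<and>
     (\<exists>f. bij_betw f (verts G) (verts H) \<and>
        (\<forall>u\<in>verts G. \<forall>v\<in>verts G. {u, v} \<in> edges G \<longleftrightarrow> {f u, f v} \<in> edges H))"

text \<open>Sets of graphs are compared up to isomorphism of their members.\<close>

definition coincide :: "'v graph set \<Rightarrow> 'w graph set \<Rightarrow> bool" (infix \<open>\<approx>\<^sub>G\<close> 50) where
  "\<A> \<approx>\<^sub>G \<B> \<longleftrightarrow> (\<forall>G\<in>\<A>. \<exists>H\<in>\<B>. G \<cong>\<^sub>G H) \<and> (\<forall>H\<in>\<B>. \<exists>G\<in>\<A>. G \<cong>\<^sub>G H)"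

definition cliques :: "nat \<Rightarrow> 'v graph \<Rightarrow> 'v set set" where
  "cliques k G = {K \<in> [verts G]\<^bsup>k\<^esup>. clique K (edges G)}"

abbreviation contains_K :: "nat \<Rightarrow> 'v graph \<Rightarrow> bool" where
  "contains_K k G \<equiv> cliques k G \<noteq> {}"

definition clique_number :: "'v graph \<Rightarrow> nat" (\<open>\<omega>\<^sub>G\<close>) where
  "\<omega>\<^sub>G G = Max {card K | K. K \<subseteq> verts G \<and> clique K (edges G)}"

definition independence_number :: "'v graph \<Rightarrow> nat" (\<open>\<alpha>\<^sub>G\<close>) where
  "\<alpha>\<^sub>G G = Max {card S | S. S \<subseteq> verts G \<and> indep S (edges G)}"

definition induced :: "'v graph \<Rightarrow> 'v set \<Rightarrow> 'v graph" where
  "induced G X = (verts G \<inter> X, {e \<in> edges G. e \<subseteq> X})"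

definition delete_verts :: "'v graph \<Rightarrow> 'v set \<Rightarrow> 'v graph" where
  "delete_verts G X = induced G (verts G - X)"

definition complement_edges :: "'v graph \<Rightarrow> 'v set set" where
  "complement_edges G = [verts G]\<^bsup>2\<^esup> - edges G"

definition add_edge :: "'v graph \<Rightarrow> 'v set \<Rightarrow> 'v graph" where
  "add_edge G e = (verts G, insert e (edges G))"

definition edgeless :: "'v set \<Rightarrow> 'v graph" where
  "edgeless S = (S, {})"

text \<open>The join; only meant for graphs with disjoint vertex sets.\<close>

definition graph_join :: "'v graph \<Rightarrow> 'v graph \<Rightarrow> 'v graph" where
  "graph_join G H = (verts G \<union> verts H,
     edges G \<union> edges H \<union> {{u, v} | u v. u \<in> verts G \<and> v \<in> verts H})"

definition cone_vertex :: "'v graph \<Rightarrow> 'v \<Rightarrow> bool" where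
  "cone_vertex G v \<longleftrightarrow> v \<in> verts G \<and> (\<forall>u \<in> verts G - {v}. {v, u} \<in> edges G)"

section \<open>Vertex Folkman graphs\<close>

text \<open>\<open>arrows G [a\<^sub>1, \<dots>, a\<^sub>s]\<close> is the relation
  \<open>G \<rightarrow>\<^sup>v (a\<^sub>1, \<dots>, a\<^sub>s)\<close>; the colors are \<open>0, \<dots>, s - 1\<close>.\<close>

definition arrows :: "'v graph \<Rightarrow> nat list \<Rightarrow> bool" where
  "arrows G as \<longleftrightarrow> (\<forall>c. c ` verts G \<subseteq> {..<length as} \<longrightarrow>
     (\<exists>i<length as. \<exists>K \<in> cliques (as ! i) G. \<forall>v\<in>K. c v = i))"

definition plus_K :: "nat \<Rightarrow> 'v graph \<Rightarrow> bool" where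
  "plus_K k G \<longleftrightarrow> (\<forall>e \<in> complement_edges G. \<exists>K. K \<in> cliques k (add_edge G e) \<and> K \<notin> cliques k G)"

definition \<H> :: "nat list \<Rightarrow> nat \<Rightarrow> nat \<Rightarrow> 'v graph set" where
  "\<H> as q n = {G. simple_graph G \<and> card (verts G) = n \<and> arrows G as \<and> \<omega>\<^sub>G G < q}"

definition \<H>_plus :: "nat \<Rightarrow> nat \<Rightarrow> nat list \<Rightarrow> nat \<Rightarrow> nat \<Rightarrow> 'v graph set" where
  "\<H>_plus t k as q n = {G \<in> \<H> as q n. plus_K k G \<and> \<alpha>\<^sub>G G \<le> t}"

definition \<H>_max :: "nat \<Rightarrow> nat list \<Rightarrow> nat \<Rightarrow> nat \<Rightarrow> 'v graph set" where
  "\<H>_max t as q n = \<H>_plus t q as q n"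

section \<open>The algorithm\<close>

definition step1 :: "nat list \<Rightarrow> nat \<Rightarrow> nat \<Rightarrow> nat \<Rightarrow> nat \<Rightarrow> 'v graph set" where
  "step1 as q n r t =
     {H \<in> \<H>_plus t (q - 1) ((hd as - 1) # tl as) q (n - r). \<nexists>v. cone_vertex H v}"

definition obtained_by_removing_edges :: "'v graph \<Rightarrow> 'w graph \<Rightarrow> bool" where
  "obtained_by_removing_edges H G \<longleftrightarrow> (\<exists>R \<subseteq> edges G. H \<cong>\<^sub>G (verts G, edges G - R))"

definition max_K_free_sets :: "nat \<Rightarrow> 'v graph \<Rightarrow> 'v set set" where
  "max_K_free_sets k H = {M. M \<subseteq> verts H \<and> \<not> contains_K k (induced H M) \<and>
     (\<forall>M'. M \<subset> M' \<and> M' \<subseteq> verts H \<longrightarrow> contains_K k (induced H M'))}"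

text \<open>In the first condition \<open>M\<^sub>1 = M\<^sub>2\<close> is allowed exactly if this set has multiplicity at least
  two. The second one is \<open>\<alpha>(H - \<Union>N') \<le> t - |N'|\<close>, rearranged to avoid truncated subtraction.\<close>

definition admissible :: "nat \<Rightarrow> nat \<Rightarrow> nat \<Rightarrow> 'v graph \<Rightarrow> 'v set multiset \<Rightarrow> bool" where
  "admissible q r t H N \<longleftrightarrow>
     size N = r \<and> set_mset N \<subseteq> max_K_free_sets (q - 1) H \<and>
     (\<forall>M\<^sub>1 M\<^sub>2. {#M\<^sub>1, M\<^sub>2#} \<subseteq># N \<longrightarrow> contains_K (q - 2) (induced H (M\<^sub>1 \<inter> M\<^sub>2))) \<and>
     (\<forall>N'. N' \<subseteq># N \<longrightarrow> \<alpha>\<^sub>G (delete_verts H (\<Union>(set_mset N'))) + size N' \<le> t)"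

text \<open>\<open>G\<close> is a graph \<open>G(N)\<close>, which is determined by \<open>H\<close> and \<open>N\<close> up to the names of the new
  vertices.\<close>

definition is_extension :: "'v graph \<Rightarrow> 'v set multiset \<Rightarrow> 'v graph \<Rightarrow> bool" where
  "is_extension H N G \<longleftrightarrow> (\<exists>Ms vs. mset Ms = N \<and> length vs = length Ms \<and> distinct vs \<and>
     set vs \<inter> verts H = {} \<and>
     G = (verts H \<union> set vs,
          edges H \<union> {{vs ! j, u} | j u. j < length vs \<and> u \<in> Ms ! j}))"

definition step2 :: "nat \<Rightarrow> nat \<Rightarrow> nat \<Rightarrow> 'v graph set \<Rightarrow> 'v graph set" where
  "step2 q r t \<A> = {G. \<exists>H\<in>\<A>. \<exists>N. admissible q r t H N \<and> is_extension H N G \<and>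
     (\<forall>e \<in> complement_edges G. \<omega>\<^sub>G (add_edge G e) = q)}"

text \<open>Step 3: \<open>\<B>'\<close> results from \<open>\<B>\<close> by keeping one graph, no matter which, of each
  isomorphism class.\<close>

definition step3 :: "'v graph set \<Rightarrow> 'v graph set \<Rightarrow> bool" where
  "step3 \<B> \<B>' \<longleftrightarrow> \<B>' \<subseteq> \<B> \<and> (\<forall>G\<in>\<B>. \<exists>G'\<in>\<B>'. G \<cong>\<^sub>G G') \<and>
     (\<forall>G\<in>\<B>'. \<forall>G'\<in>\<B>'. G \<cong>\<^sub>G G' \<longrightarrow> G = G')"

definition step4 :: "nat list \<Rightarrow> 'v graph set \<Rightarrow> 'v graph set" where
  "step4 as \<B> = {G \<in> \<B>. arrows G as}"

definition step5 :: "nat list \<Rightarrow> nat \<Rightarrow> nat \<Rightarrow> 'v graph set \<Rightarrow> 'v graph set" where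
  "step5 as r t \<A>\<^sub>1 = (if t > r then
     {graph_join (edgeless S) H | S H. simple_graph H \<and> finite S \<and> card S = r + 1 \<and>
        S \<inter> verts H = {} \<and>
        (\<exists>c. c \<notin> verts H \<and> graph_join (edgeless {c}) H \<in> \<A>\<^sub>1 \<and>
           (\<exists>!v. cone_vertex (graph_join (edgeless {c}) H) v) \<and>
           arrows (graph_join (edgeless {c}) H) as)}
     else {})"

definition step6 :: "nat list \<Rightarrow> nat \<Rightarrow> 'v graph set \<Rightarrow> 'v graph set" where
  "step6 as r \<A>\<^sub>2 = {graph_join (edgeless {c}) H | c H. H \<in> \<A>\<^sub>2 \<and> \<alpha>\<^sub>G H \<ge> r \<and> c \<notin> verts H \<and>
     arrows (graph_join (edgeless {c}) H) as}"

text \<open>\<open>\<B>\<close> is a possible output on the inputs \<open>\<A>\<^sub>1\<close> and \<open>\<A>\<^sub>2\<close>.\<close>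

definition algorithm_B ::
  "nat list \<Rightarrow> nat \<Rightarrow> nat \<Rightarrow> nat \<Rightarrow> nat \<Rightarrow> 'v graph set \<Rightarrow> 'v graph set \<Rightarrow> 'v graph set \<Rightarrow> bool" where
  "algorithm_B as q n r t \<A>\<^sub>1 \<A>\<^sub>2 \<B> \<longleftrightarrow>
     (\<exists>\<B>\<^sub>3. step3 (step2 q r t (step1 as q n r t)) \<B>\<^sub>3 \<and>
        \<B> = step4 as \<B>\<^sub>3 \<union> step5 as r t \<A>\<^sub>1 \<union> step6 as r \<A>\<^sub>2)"

section \<open>The algorithm always has an output\<close>

lemma graph_iso_refl: "simple_graph G \<Longrightarrow> G \<cong>\<^sub>G G"
  unfolding graph_iso_def by (auto intro!: exI[of _ id])

lemma graph_iso_sym: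
  assumes "G \<cong>\<^sub>G H" shows "H \<cong>\<^sub>G G"
proof -
  from assms obtain f where f: "bij_betw f (verts G) (verts H)"
    "\<forall>u\<in>verts G. \<forall>v\<in>verts G. {u, v} \<in> edges G \<longleftrightarrow> {f u, f v} \<in> edges H"
    and s: "simple_graph G" "simple_graph H"
    unfolding graph_iso_def by blast
  let ?g = "inv_into (verts G) f"
  have g: "bij_betw ?g (verts H) (verts G)" using f(1) by (rule bij_betw_inv_into)
  have "{u, v} \<in> edges H \<longleftrightarrow> {?g u, ?g v} \<in> edges G" if "u \<in> verts H" "v \<in> verts H" for u v
    using f(2) that bij_betw_inv_into_right[OF f(1)] bij_betwE[OF g] by metis
  with g s show ?thesis unfolding graph_iso_def by blast
qed

lemma graph_iso_trans:
  assumes "G \<cong>\<^sub>G H" "H \<cong>\<^sub>G K" shows "G \<cong>\<^sub>G K"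
proof -
  from assms(1) obtain f where f: "bij_betw f (verts G) (verts H)"
    "\<forall>u\<in>verts G. \<forall>v\<in>verts G. {u, v} \<in> edges G \<longleftrightarrow> {f u, f v} \<in> edges H"
    unfolding graph_iso_def by blast
  from assms(2) obtain g where g: "bij_betw g (verts H) (verts K)"
    "\<forall>u\<in>verts H. \<forall>v\<in>verts H. {u, v} \<in> edges H \<longleftrightarrow> {g u, g v} \<in> edges K"
    unfolding graph_iso_def by blast
  have "bij_betw (g \<circ> f) (verts G) (verts K)" using f(1) g(1) by (rule bij_betw_trans)
  moreover have "{u, v} \<in> edges G \<longleftrightarrow> {(g \<circ> f) u, (g \<circ> f) v} \<in> edges K"
    if "u \<in> verts G" "v \<in> verts G" for u v
    using f(2) g(2) that bij_betwE[OF f(1)] by simp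
  ultimately show ?thesis using assms unfolding graph_iso_def by blast
qed

lemma simple_graph_extension:
  assumes H: "simple_graph H" and N: "set_mset N \<subseteq> Pow (verts H)" and "is_extension H N G"
  shows "simple_graph G"
proof -
  from assms(3) obtain Ms vs where *: "mset Ms = N" "length vs = length Ms"
    "set vs \<inter> verts H = {}"
    "G = (verts H \<union> set vs, edges H \<union> {{vs ! j, u} | j u. j < length vs \<and> u \<in> Ms ! j})"
    unfolding is_extension_def by blast
  have "{vs ! j, u} \<in> [verts G]\<^bsup>2\<^esup>" if "j < length vs" "u \<in> Ms ! j" for j u
  proof -
    have "Ms ! j \<in># N" using that(1) *(1,2) nth_mem_mset by metis
    then have "u \<in> verts H" using N that(2) by blast
    moreover have "vs ! j \<in> set vs" using that(1) by simp
    ultimately show ?thesis using *(3,4) by (auto simp: nsets_def card_insert_if)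
  qed
  moreover have "edges H \<subseteq> [verts G]\<^bsup>2\<^esup>"
    using H *(4) by (auto simp: simple_graph_def nsets_def)
  ultimately show ?thesis using H *(4) by (auto simp: simple_graph_def)
qed

lemma step3_exists:
  fixes \<B> :: "'v graph set"
  assumes "\<forall>G\<in>\<B>. simple_graph G"
  shows "\<exists>\<B>'. step3 \<B> \<B>'"
proof -
  define c where "c G = (SOME G'. G' \<in> \<B> \<and> G \<cong>\<^sub>G G')" for G :: "'v graph"
  have c: "c G \<in> \<B> \<and> G \<cong>\<^sub>G c G" if "G \<in> \<B>" for G
    unfolding c_def by (rule someI[of _ G]) (use that assms graph_iso_refl in blast)
  have "c G = c G'" if "G \<cong>\<^sub>G G'" for G G'
  proof -
    have "G \<cong>\<^sub>G K \<longleftrightarrow> G' \<cong>\<^sub>G K" for K :: "'v graph"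
      using graph_iso_trans[OF that, of K] graph_iso_trans[OF graph_iso_sym[OF that], of K] by blast
    then show ?thesis by (simp add: c_def)
  qed
  moreover have "G \<cong>\<^sub>G G'" if "G \<in> \<B>" "G' \<in> \<B>" "c G \<cong>\<^sub>G c G'" for G G'
    using graph_iso_trans[OF graph_iso_trans[OF c[OF that(1), THEN conjunct2] that(3)]
        graph_iso_sym[OF c[OF that(2), THEN conjunct2]]] .
  ultimately have "c G = c G'" if "G \<in> \<B>" "G' \<in> \<B>" "c G \<cong>\<^sub>G c G'" for G G'
    using that by metis
  then have "step3 \<B> (c ` \<B>)"
    unfolding step3_def using c by (simp add: image_subset_iff) blast
  then show ?thesis ..
qed

lemma algorithm_B_exists: "\<exists>\<B>. algorithm_B as q n r t \<A>\<^sub>1 \<A>\<^sub>2 \<B>"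
proof -
  have "simple_graph G" if G: "G \<in> step2 q r t (step1 as q n r t)" for G :: "'a graph"
  proof -
    from G obtain H N where "H \<in> step1 as q n r t" "admissible q r t H N" "is_extension H N G"
      unfolding step2_def by blast
    moreover from this have "simple_graph H" by (simp add: step1_def \<H>_plus_def \<H>_def)
    moreover have "set_mset N \<subseteq> Pow (verts H)"
      using \<open>admissible q r t H N\<close> by (auto simp: admissible_def max_K_free_sets_def)
    ultimately show ?thesis using simple_graph_extension by blast
  qed
  then have "\<forall>G \<in> step2 q r t (step1 as q n r t). simple_graph (G :: 'a graph)" by blast
  from step3_exists[OF this] show ?thesis unfolding algorithm_B_def by blast
qed

end

theory Submission
  imports Defs
begin

text \<open>
  Soundness: a clique of \<open>G(N)\<close> contains at most one new vertex \<open>v\<^sub>j\<close>, hence a \<open>K\<^sub>q\<close> would put a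
  \<open>K\<^sub>q\<^sub>-\<^sub>1\<close> into some \<open>M\<close>, and an independent set splits into new vertices and a part of \<open>H\<close> that
  avoids their neighbourhoods, which condition (b) bounds. For the joins in steps 5 and 6, all
  relevant parameters are determined by those of \<open>H\<close>.

  Completeness: given \<open>G\<close>, take an independent set \<open>S\<close> of size \<open>r\<close> and put \<open>H = G - S\<close>. Since \<open>G\<close> is
  maximal \<open>K\<^sub>q\<close>-free, the neighbourhoods of the vertices of \<open>S\<close> are maximal \<open>K\<^sub>q\<^sub>-\<^sub>1\<close>-free sets of \<open>H\<close>
  satisfying (a) and (b), so step 2 finds \<open>G\<close> if \<open>H\<close> has no cone vertex. If \<open>G\<close> has a cone vertex,
  step 6 finds it. Otherwise a cone vertex \<open>c\<close> of \<open>H\<close> is a twin of every vertex of \<open>S\<close>, so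
  \<open>G\<close> is the join of the edgeless graph on \<open>S \<union> {c}\<close> with \<open>H - c\<close>, found in step 5.
  As \<open>a\<^sub>1 \<ge> 2\<close>, the arrow relation forces \<open>q \<ge> 3\<close>.
\<close>

section \<open>Cliques, independent sets and isomorphisms\<close>

lemma cliqueD: "clique K E \<Longrightarrow> u \<in> K \<Longrightarrow> v \<in> K \<Longrightarrow> u \<noteq> v \<Longrightarrow> {u, v} \<in> E"
  by (simp add: clique_def)

lemma indepD: "indep S E \<Longrightarrow> u \<in> S \<Longrightarrow> v \<in> S \<Longrightarrow> u \<noteq> v \<Longrightarrow> {u, v} \<notin> E"
  by (simp add: indep_def)

lemma clique_subset: "clique K E \<Longrightarrow> L \<subseteq> K \<Longrightarrow> clique L E"
  by (auto simp: clique_def)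

lemma clique_insert_iff:
  "clique (insert u Q) E \<longleftrightarrow> clique Q E \<and> (\<forall>w\<in>Q. w \<noteq> u \<longrightarrow> {u, w} \<in> E)"
  by (auto simp: clique_def insert_commute)

lemma in_cliques_iff:
  "K \<in> cliques k G \<longleftrightarrow> K \<subseteq> verts G \<and> finite K \<and> card K = k \<and> clique K (edges G)"
  by (auto simp: cliques_def nsets_def)

lemma contains_K_iff:
  "contains_K k G \<longleftrightarrow> (\<exists>K \<subseteq> verts G. finite K \<and> card K = k \<and> clique K (edges G))"
  unfolding ex_in_conv[symmetric] in_cliques_iff by blast

lemma edge_in_simple_graph:
  assumes "simple_graph G" "{u, v} \<in> edges G"
  shows "u \<in> verts G" "v \<in> verts G" "u \<noteq> v"
  using assms by (auto simp: simple_graph_def nsets_def)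

lemma clique_of_smaller_size:
  assumes "K \<subseteq> verts G" "clique K (edges G)" "k \<le> card K"
  shows "contains_K k G"
proof -
  obtain L where "L \<subseteq> K" "finite L" "card L = k"
    using obtain_subset_with_card_n[OF assms(3)] by blast
  then have "L \<in> cliques k G"
    using assms clique_subset by (auto simp: in_cliques_iff)
  then show ?thesis by blast
qed

lemma finite_subset_cards:
  "finite V \<Longrightarrow> finite {card K | K. K \<subseteq> V \<and> P K}"
  by (rule finite_surj[of "Pow V" _ card]) auto

text \<open>Subsets of cliques are cliques, so excluding size exactly \<open>q\<close> excludes all
  larger sizes as well. The empty clique makes the set under \<open>Max\<close> nonempty.\<close>

lemma clique_number_less_iff:
  assumes "finite (verts G)"
  shows "\<omega>\<^sub>G G < q \<longleftrightarrow> cliques q G = {}"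
proof -
  let ?C = "{card K | K. K \<subseteq> verts G \<and> clique K (edges G)}"
  have "?C \<noteq> {}" by (auto simp: clique_def)
  then have "\<omega>\<^sub>G G < q \<longleftrightarrow> (\<forall>x\<in>?C. x < q)"
    unfolding clique_number_def by (rule Max_less_iff[OF finite_subset_cards[OF assms]])
  also have "\<dots> \<longleftrightarrow> cliques q G = {}"
  proof
    assume "\<forall>x\<in>?C. x < q"
    then have "card K \<noteq> q" if "K \<subseteq> verts G" "clique K (edges G)" for K using that by blast
    then show "cliques q G = {}" unfolding cliques_def nsets_def by blast
  next
    assume "cliques q G = {}"
    then show "\<forall>x\<in>?C. x < q"
      using clique_of_smaller_size[of _ G q] not_less by blast
  qed
  finally show ?thesis .
qed

lemma independence_number_le_iff:
  assumes "finite (verts G)"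
  shows "\<alpha>\<^sub>G G \<le> t \<longleftrightarrow> (\<forall>S \<subseteq> verts G. indep S (edges G) \<longrightarrow> card S \<le> t)"
proof -
  let ?C = "{card S | S. S \<subseteq> verts G \<and> indep S (edges G)}"
  have "?C \<noteq> {}" by (auto simp: indep_def)
  then show ?thesis
    unfolding independence_number_def
    by (subst Max_le_iff[OF finite_subset_cards[OF assms]]) blast+
qed

text \<open>The maximum is attained, and a subset of an independent set is independent, so a witness
  can be cut down to exactly \<open>r\<close> vertices. This supplies the set \<open>S\<close> that
  is deleted from \<open>G\<close> for completeness.\<close>

lemma le_independence_number_iff:
  assumes "finite (verts G)"
  shows "r \<le> \<alpha>\<^sub>G G \<longleftrightarrow> (\<exists>S \<subseteq> verts G. indep S (edges G) \<and> card S = r)"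
proof
  let ?C = "{card S | S. S \<subseteq> verts G \<and> indep S (edges G)}"
  have "?C \<noteq> {}" by (auto simp: indep_def)
  then have "\<alpha>\<^sub>G G \<in> ?C"
    unfolding independence_number_def by (rule Max_in[OF finite_subset_cards[OF assms]])
  then obtain S where S: "S \<subseteq> verts G" "indep S (edges G)" "card S = \<alpha>\<^sub>G G" by force
  assume "r \<le> \<alpha>\<^sub>G G"
  then obtain T where "T \<subseteq> S" "card T = r"
    using obtain_subset_with_card_n[of r S] S(3) by metis
  with S show "\<exists>S \<subseteq> verts G. indep S (edges G) \<and> card S = r"
    unfolding indep_def by (intro exI[of _ T]) blast
next
  assume "\<exists>S \<subseteq> verts G. indep S (edges G) \<and> card S = r"
  then show "r \<le> \<alpha>\<^sub>G G" using independence_number_le_iff[OF assms, of "\<alpha>\<^sub>G G"] by blast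
qed

text \<open>A clique that is new in \<open>add_edge G {u, v}\<close> must contain both ends of the
  added edge; without them it leaves a set \<open>Q\<close> that completes \<open>u\<close> and
  \<open>v\<close> alike. This form speaks about \<open>G\<close> alone and is the one through which
  maximality is exploited.\<close>

lemma plus_K_iff:
  assumes "simple_graph G"
  shows "plus_K k G \<longleftrightarrow> (\<forall>u\<in>verts G. \<forall>v\<in>verts G. u \<noteq> v \<longrightarrow> {u, v} \<notin> edges G \<longrightarrow>
    (\<exists>Q \<subseteq> verts G. u \<notin> Q \<and> v \<notin> Q \<and> card Q + 2 = k \<and>
       clique (insert u Q) (edges G) \<and> clique (insert v Q) (edges G)))"
    (is "_ \<longleftrightarrow> (\<forall>u\<in>_. \<forall>v\<in>_. _ \<longrightarrow> _ \<longrightarrow> ?P u v)")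
proof -
  have fin: "finite (verts G)" using assms by (simp add: simple_graph_def)
  have *: "(\<exists>K. K \<in> cliques k (add_edge G {u, v}) \<and> K \<notin> cliques k G) \<longleftrightarrow> ?P u v"
    if uv: "u \<in> verts G" "v \<in> verts G" "u \<noteq> v" "{u, v} \<notin> edges G" for u v
  proof
    assume "\<exists>K. K \<in> cliques k (add_edge G {u, v}) \<and> K \<notin> cliques k G"
    then obtain K where K: "K \<subseteq> verts G" "finite K" "card K = k"
      "clique K (insert {u, v} (edges G))" "\<not> clique K (edges G)"
      by (auto simp: in_cliques_iff add_edge_def)
    then have "u \<in> K" "v \<in> K" by (auto simp: clique_def doubleton_eq_iff)
    moreover have "card (K - {u, v}) + 2 = card K"
    proof -
      have "card (K - {u, v}) = card K - 2"
        using \<open>u \<in> K\<close> \<open>v \<in> K\<close> uv(3) by (subst card_Diff_subset) auto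
      moreover have "2 \<le> card K"
        using card_mono[of K "{u, v}"] K(2) \<open>u \<in> K\<close> \<open>v \<in> K\<close> uv(3) by simp
      ultimately show ?thesis by simp
    qed
    moreover have "clique (insert u (K - {u, v})) (edges G)" "clique (insert v (K - {u, v})) (edges G)"
      using K(4) \<open>u \<in> K\<close> \<open>v \<in> K\<close> uv(3) by (auto simp: clique_def doubleton_eq_iff)
    ultimately show "?P u v" using K by (intro exI[of _ "K - {u, v}"]) auto
  next
    assume "?P u v"
    then obtain Q where Q: "Q \<subseteq> verts G" "u \<notin> Q" "v \<notin> Q" "card Q + 2 = k"
      "clique (insert u Q) (edges G)" "clique (insert v Q) (edges G)" by blast
    have "finite Q" using Q(1) fin by (rule finite_subset)
    have "clique (insert u (insert v Q)) (insert {u, v} (edges G))"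
      using Q(5,6) unfolding clique_insert_iff clique_def by blast
    with \<open>finite Q\<close> have "insert u (insert v Q) \<in> cliques k (add_edge G {u, v})"
      using Q(1-4) uv by (simp add: in_cliques_iff add_edge_def)
    moreover have "insert u (insert v Q) \<notin> cliques k G"
      using uv by (auto simp: in_cliques_iff clique_def)
    ultimately show "\<exists>K. K \<in> cliques k (add_edge G {u, v}) \<and> K \<notin> cliques k G" by blast
  qed
  show ?thesis
  proof (intro iffI ballI impI)
    fix u v assume "plus_K k G" and uv: "u \<in> verts G" "v \<in> verts G" "u \<noteq> v" "{u, v} \<notin> edges G"
    then have "{u, v} \<in> complement_edges G" by (simp add: complement_edges_def)
    with \<open>plus_K k G\<close> show "?P u v" unfolding plus_K_def *[OF uv, symmetric] by (rule bspec)
  next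
    assume P: "\<forall>u\<in>verts G. \<forall>v\<in>verts G. u \<noteq> v \<longrightarrow> {u, v} \<notin> edges G \<longrightarrow> ?P u v"
    show "plus_K k G"
      unfolding plus_K_def
    proof
      fix e assume "e \<in> complement_edges G"
      then have e: "e \<in> [verts G]\<^bsup>2\<^esup>" "e \<notin> edges G" by (auto simp: complement_edges_def)
      from e(1) obtain u v where uv: "e = {u, v}" "u \<in> verts G" "v \<in> verts G" "u \<noteq> v"
        by (rule nsets2_E)
      with P e(2) have "?P u v" by blast
      with * uv e(2) show "\<exists>K. K \<in> cliques k (add_edge G e) \<and> K \<notin> cliques k G" by metis
    qed
  qed
qed

lemma plus_KE:
  assumes "simple_graph G" "plus_K k G" "u \<in> verts G" "v \<in> verts G" "u \<noteq> v" "{u, v} \<notin> edges G"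
  obtains Q where "Q \<subseteq> verts G" "finite Q" "u \<notin> Q" "v \<notin> Q" "card Q + 2 = k"
    "clique (insert u Q) (edges G)" "clique (insert v Q) (edges G)"
proof -
  obtain Q where Q: "Q \<subseteq> verts G" "u \<notin> Q" "v \<notin> Q" "card Q + 2 = k"
    "clique (insert u Q) (edges G)" "clique (insert v Q) (edges G)"
    using assms plus_K_iff[OF assms(1)] by meson
  moreover have "finite Q" using Q(1) assms(1) finite_subset by (auto simp: simple_graph_def)
  ultimately show ?thesis using that by blast
qed

section \<open>The arrow relation\<close>

lemma arrowsE:
  assumes "arrows G as" "c ` verts G \<subseteq> {..<length as}"
  obtains i K where "i < length as" "K \<in> cliques (as ! i) G" "\<forall>v\<in>K. c v = i"
proof -
  have "\<exists>i<length as. \<exists>K \<in> cliques (as ! i) G. \<forall>v\<in>K. c v = i"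
    using assms(2) by (rule assms(1)[unfolded arrows_def, rule_format])
  with that show thesis by blast
qed

lemma cliques_nonempty: "K \<in> cliques k G \<Longrightarrow> k > 0 \<Longrightarrow> K \<noteq> {} \<and> K \<subseteq> verts G"
  by (auto simp: in_cliques_iff)

text \<open>Without vertices every coloring is vacuous, but a clique of positive size needs a
  vertex. In the soundness proof this shows that \<open>n - r\<close> is not a truncated
  difference.\<close>

lemma arrows_verts_nonempty:
  assumes "arrows G as" "\<forall>a \<in> set as. a > 0"
  shows "verts G \<noteq> {}"
proof
  assume "verts G = {}"
  then have "(\<lambda>_. 0) ` verts G \<subseteq> {..<length as}" by simp
  then obtain i K where i: "i < length as" "K \<in> cliques (as ! i) G" "\<forall>v\<in>K. 0 = i"
    by (rule arrowsE[OF assms(1)])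
  have "as ! i > 0" using assms(2) i(1) by simp
  from cliques_nonempty[OF i(2) this] \<open>verts G = {}\<close> show False by blast
qed

text \<open>Give every vertex color 0. A monochromatic clique of another color would have to be
  empty, which the positive sizes rule out. In a graph without \<open>q\<close>-cliques this yields
  \<open>a < q\<close>.\<close>

lemma arrows_contains_hd:
  assumes "arrows G (a # as)" "\<forall>b \<in> set as. b > 0"
  shows "contains_K a G"
proof -
  have "(\<lambda>_. 0) ` verts G \<subseteq> {..<length (a # as)}" by auto
  then obtain i K where i: "i < length (a # as)" "K \<in> cliques ((a # as) ! i) G"
    and 0: "\<forall>v\<in>K. 0 = i"
    by (rule arrowsE[OF assms(1)])
  show ?thesis
  proof (cases i)
    case 0
    with i(2) show ?thesis by auto
  next
    case (Suc j)
    with i have "as ! j \<in> set as" by simp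
    with assms(2) have "as ! j > 0" by blast
    with i(2) Suc have "K \<noteq> {}" using cliques_nonempty[of K "as ! j" G] by simp
    with 0 Suc show ?thesis by blast
  qed
qed

section \<open>Induced subgraphs and equality of graphs\<close>

lemma verts_induced [simp]: "verts (induced G X) = verts G \<inter> X"
  and edge_induced: "{u, v} \<in> edges (induced G X) \<longleftrightarrow> {u, v} \<in> edges G \<and> u \<in> X \<and> v \<in> X"
  by (auto simp: induced_def)

lemma verts_delete_verts [simp]: "verts (delete_verts G X) = verts G - X"
  by (auto simp: delete_verts_def)

lemma edge_delete_verts:
  "simple_graph G \<Longrightarrow> {u, v} \<in> edges (delete_verts G X) \<longleftrightarrow> {u, v} \<in> edges G \<and> u \<notin> X \<and> v \<notin> X"
  by (auto simp: delete_verts_def edge_induced dest: edge_in_simple_graph)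

lemma simple_graph_induced: "simple_graph G \<Longrightarrow> simple_graph (induced G X)"
  by (auto simp: simple_graph_def induced_def nsets_def)

lemma simple_graph_delete_verts: "simple_graph G \<Longrightarrow> simple_graph (delete_verts G X)"
  by (simp add: delete_verts_def simple_graph_induced)

lemma clique_induced_iff:
  "K \<subseteq> X \<Longrightarrow> clique K (edges (induced G X)) \<longleftrightarrow> clique K (edges G)"
  by (auto simp: clique_def edge_induced)

lemma clique_delete_verts_iff:
  "K \<subseteq> verts G - X \<Longrightarrow> clique K (edges (delete_verts G X)) \<longleftrightarrow> clique K (edges G)"
  by (simp add: delete_verts_def clique_induced_iff)

lemma indep_delete_verts_iff:
  "K \<subseteq> verts G - X \<Longrightarrow> indep K (edges (delete_verts G X)) \<longleftrightarrow> indep K (edges G)"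
  by (auto simp: delete_verts_def edge_induced indep_def)

lemma cliques_induced: "cliques k (induced G X) = {K \<in> cliques k G. K \<subseteq> X}"
  using clique_induced_iff[of _ X G] by (auto simp: in_cliques_iff)

text \<open>Edges of simple graphs have exactly two elements, so adjacency decides every possible
  edge. Decompositions of \<open>G\<close> can thus be literal equations instead of
  isomorphisms.\<close>

lemma simple_graph_eqI:
  assumes "simple_graph G" "simple_graph H" "verts G = verts H"
    "\<And>u v. {u, v} \<in> edges G \<longleftrightarrow> {u, v} \<in> edges H"
  shows "G = H"
proof -
  have "edges G = edges H"
  proof (rule set_eqI)
    fix e
    show "e \<in> edges G \<longleftrightarrow> e \<in> edges H"
    proof (cases "card e = 2")
      case True
      then show ?thesis using assms(4) by (auto simp: card_2_iff)
    next
      case False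
      then show ?thesis using assms(1,2) by (auto simp: simple_graph_def nsets_def)
    qed
  qed
  with assms(3) show ?thesis by (simp add: prod_eq_iff)
qed

section \<open>Invariance under isomorphism\<close>

definition iso_map :: "('v \<Rightarrow> 'w) \<Rightarrow> 'v graph \<Rightarrow> 'w graph \<Rightarrow> bool" where
  "iso_map f G H \<longleftrightarrow> inj_on f (verts G) \<and> verts H = f ` verts G \<and>
     (\<forall>u\<in>verts G. \<forall>v\<in>verts G. {f u, f v} \<in> edges H \<longleftrightarrow> {u, v} \<in> edges G)"

lemma iso_mapD:
  assumes "iso_map f G H"
  shows "inj_on f (verts G)" "verts H = f ` verts G"
    "u \<in> verts G \<Longrightarrow> v \<in> verts G \<Longrightarrow> {f u, f v} \<in> edges H \<longleftrightarrow> {u, v} \<in> edges G"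
  using assms by (auto simp: iso_map_def)

text \<open>Separates the map from the simplicity conditions, so that one fixed \<open>f\<close> can
  be named and reused, for instance to follow a cone vertex and its deletion.\<close>

lemma graph_iso_iff:
  "G \<cong>\<^sub>G H \<longleftrightarrow> simple_graph G \<and> simple_graph H \<and> (\<exists>f. iso_map f G H)"
  unfolding graph_iso_def iso_map_def bij_betw_def by metis

text \<open>The basic transport fact: clique-freeness, the arrow relation and \<open>plus_K\<close>
  all pass along an isomorphism by moving cliques with \<open>f\<close>.\<close>

lemma cliques_image:
  assumes f: "iso_map f G H" and "K \<in> cliques k G"
  shows "f ` K \<in> cliques k H"
proof -
  have K: "K \<subseteq> verts G" "finite K" "card K = k" "clique K (edges G)"
    using assms(2) by (auto simp: in_cliques_iff)
  have "inj_on f K" using iso_mapD(1)[OF f] K(1) by (rule inj_on_subset)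
  then have "card (f ` K) = k" using K(3) by (simp add: card_image)
  moreover have "clique (f ` K) (edges H)"
    unfolding clique_def
  proof (intro ballI impI)
    fix x y assume "x \<in> f ` K" "y \<in> f ` K" "x \<noteq> y"
    then obtain u v where "u \<in> K" "v \<in> K" "x = f u" "y = f v" "u \<noteq> v" by blast
    then show "{x, y} \<in> edges H"
      using K(1,4) iso_mapD(3)[OF f, of u v] by (auto simp: clique_def)
  qed
  moreover have "f ` K \<subseteq> verts H" using K(1) iso_mapD(2)[OF f] by blast
  ultimately show ?thesis using K(2) by (simp add: in_cliques_iff)
qed

lemma contains_K_iso: "G \<cong>\<^sub>G H \<Longrightarrow> contains_K k G \<Longrightarrow> contains_K k H"
  unfolding graph_iso_iff using cliques_image by blast

lemma arrows_iso:
  assumes "G \<cong>\<^sub>G H" "arrows G as"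
  shows "arrows H as"
proof -
  obtain f where f: "iso_map f G H" and s: "simple_graph G" "simple_graph H"
    using assms by (auto simp: graph_iso_iff)
  show ?thesis unfolding arrows_def
  proof (intro allI impI)
    fix c assume "c ` verts H \<subseteq> {..<length as}"
    \<comment> \<open>Colorings are pulled back along \<open>f\<close>, while the monochromatic
      clique is pushed forward.\<close>
    then have "(c \<circ> f) ` verts G \<subseteq> {..<length as}" using iso_mapD(2)[OF f] by auto
    then obtain i K where K: "i < length as" "K \<in> cliques (as ! i) G" "\<forall>v\<in>K. (c \<circ> f) v = i"
      by (rule arrowsE[OF assms(2)])
    have "f ` K \<in> cliques (as ! i) H" using cliques_image[OF f K(2)] .
    moreover have "\<forall>v \<in> f ` K. c v = i" using K(3) by simp
    ultimately show "\<exists>i<length as. \<exists>K\<in>cliques (as ! i) H. \<forall>v\<in>K. c v = i" using K(1) by metis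
  qed
qed

lemma independence_number_iso_le:
  assumes "G \<cong>\<^sub>G H"
  shows "\<alpha>\<^sub>G G \<le> \<alpha>\<^sub>G H"
proof -
  obtain f where f: "iso_map f G H" and s: "simple_graph G" "simple_graph H"
    using assms by (auto simp: graph_iso_iff)
  from s have fin: "finite (verts G)" "finite (verts H)" by (auto simp: simple_graph_def)
  obtain S where S: "S \<subseteq> verts G" "indep S (edges G)" "card S = \<alpha>\<^sub>G G"
    using le_independence_number_iff[OF fin(1)] by blast
  have "card (f ` S) = \<alpha>\<^sub>G G" using S iso_mapD(1)[OF f] by (metis card_image inj_on_subset)
  moreover have "indep (f ` S) (edges H)" using S iso_mapD(3)[OF f] by (auto simp: indep_def subset_iff)
  moreover have "f ` S \<subseteq> verts H" using S iso_mapD(2)[OF f] by auto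
  ultimately show ?thesis using le_independence_number_iff[OF fin(2)] by blast
qed

lemma independence_number_iso: "G \<cong>\<^sub>G H \<Longrightarrow> \<alpha>\<^sub>G G = \<alpha>\<^sub>G H"
  using independence_number_iso_le graph_iso_sym le_antisym by metis

lemma plus_K_iso:
  assumes "G \<cong>\<^sub>G H" "plus_K k G"
  shows "plus_K k H"
proof -
  obtain f where f: "iso_map f G H" and s: "simple_graph G" "simple_graph H"
    using assms by (auto simp: graph_iso_iff)
  show ?thesis unfolding plus_K_iff[OF s(2)]
  proof (intro ballI impI)
    fix x y assume xy: "x \<in> verts H" "y \<in> verts H" "x \<noteq> y" "{x, y} \<notin> edges H"
    then obtain u v where uv: "u \<in> verts G" "v \<in> verts G" "x = f u" "y = f v"
      using iso_mapD(2)[OF f] by blast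
    with xy have "u \<noteq> v" "{u, v} \<notin> edges G" using iso_mapD(3)[OF f, of u v] by auto
    from plus_KE[OF s(1) assms(2) uv(1,2) this]
    obtain Q where Q: "Q \<subseteq> verts G" "finite Q" "u \<notin> Q" "v \<notin> Q" "card Q + 2 = k"
      "clique (insert u Q) (edges G)" "clique (insert v Q) (edges G)" by blast
    have "clique (insert (f w) (f ` Q)) (edges H)"
      if "clique (insert w Q) (edges G)" "w \<notin> Q" "w \<in> verts G" for w
    proof -
      have "insert w Q \<in> cliques (Suc (card Q)) G" using that Q(1,2) by (simp add: in_cliques_iff)
      from cliques_image[OF f this] show ?thesis by (simp add: in_cliques_iff)
    qed
    then have 1: "clique (insert x (f ` Q)) (edges H)" "clique (insert y (f ` Q)) (edges H)"
      using Q uv by simp_all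
    have 2: "card (f ` Q) = card Q"
      using Q(1) iso_mapD(1)[OF f] by (metis card_image inj_on_subset)
    have 3: "f w \<notin> f ` Q" if "w \<notin> Q" "w \<in> verts G" for w
      using that Q(1) inj_on_image_mem_iff[OF iso_mapD(1)[OF f]] by blast
    have "f ` Q \<subseteq> verts H" using Q(1) iso_mapD(2)[OF f] by blast
    moreover have "x \<notin> f ` Q" "y \<notin> f ` Q" using 3 Q(3,4) uv by simp_all
    moreover have "card (f ` Q) + 2 = k" using 2 Q(5) by simp
    ultimately show "\<exists>Q\<subseteq>verts H. x \<notin> Q \<and> y \<notin> Q \<and> card Q + 2 = k \<and>
        clique (insert x Q) (edges H) \<and> clique (insert y Q) (edges H)"
      using 1 by (intro exI[of _ "f ` Q"] conjI)
  qed
qed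

lemma cone_vertex_image:
  assumes "iso_map f G H" "v \<in> verts G"
  shows "cone_vertex H (f v) \<longleftrightarrow> cone_vertex G v"
proof -
  have "f v \<in> verts H" using assms(2) iso_mapD(2)[OF assms(1)] by blast
  moreover have "f ` verts G - {f v} = f ` (verts G - {v})"
    using inj_on_image_set_diff[OF iso_mapD(1)[OF assms(1)], of "verts G" "{v}"] assms(2) by simp
  moreover have "{f v, f u} \<in> edges H \<longleftrightarrow> {v, u} \<in> edges G" if "u \<in> verts G" for u
    using iso_mapD(3)[OF assms(1) assms(2) that] .
  ultimately show ?thesis
    using assms(2) unfolding cone_vertex_def iso_mapD(2)[OF assms(1)] by simp
qed

lemma in_\<H>_plus_iff:
  "G \<in> \<H>_plus t k as q n \<longleftrightarrow> simple_graph G \<and> card (verts G) = n \<and> arrows G as \<and>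
     cliques q G = {} \<and> plus_K k G \<and> \<alpha>\<^sub>G G \<le> t"
  using clique_number_less_iff[of G q] by (auto simp: \<H>_plus_def \<H>_def simple_graph_def)

lemma \<H>_plus_iso:
  assumes "G \<cong>\<^sub>G H" "G \<in> \<H>_plus t k as q n"
  shows "H \<in> \<H>_plus t k as q n"
proof -
  obtain f where "iso_map f G H" using assms(1) by (auto simp: graph_iso_iff)
  then have "card (verts H) = card (verts G)" using card_image iso_mapD(1,2) by metis
  moreover have "simple_graph H" using assms(1) by (simp add: graph_iso_iff)
  moreover have "cliques q H = {}"
    using contains_K_iso[OF graph_iso_sym[OF assms(1)], of q] assms(2) by (auto simp: in_\<H>_plus_iff)
  ultimately show ?thesis
    using assms(2) arrows_iso[OF assms(1)] plus_K_iso[OF assms(1)] independence_number_iso[OF assms(1)]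
    by (simp add: in_\<H>_plus_iff)
qed

section \<open>Joins with edgeless graphs\<close>

context
  fixes S :: "'v set" and H :: "'v graph"
  assumes H: "simple_graph H" and S: "finite S" "S \<inter> verts H = {}"
begin

lemma verts_join_edgeless: "verts (graph_join (edgeless S) H) = S \<union> verts H"
  by (simp add: graph_join_def edgeless_def)

lemma edge_join_edgeless:
  "{u, v} \<in> edges (graph_join (edgeless S) H) \<longleftrightarrow>
     {u, v} \<in> edges H \<or> u \<in> S \<and> v \<in> verts H \<or> v \<in> S \<and> u \<in> verts H"
  by (auto simp: graph_join_def edgeless_def doubleton_eq_iff)

lemma edge_join_edgeless_cases:
  "u \<in> S \<Longrightarrow> v \<in> S \<Longrightarrow> {u, v} \<notin> edges (graph_join (edgeless S) H)"
  "u \<in> S \<Longrightarrow> v \<in> verts H \<Longrightarrow> {u, v} \<in> edges (graph_join (edgeless S) H)"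
  "u \<in> verts H \<Longrightarrow> v \<in> verts H \<Longrightarrow>
     {u, v} \<in> edges (graph_join (edgeless S) H) \<longleftrightarrow> {u, v} \<in> edges H"
  unfolding edge_join_edgeless using S(2) edge_in_simple_graph(1)[OF H, of u v] by blast+

lemma simple_graph_join_edgeless: "simple_graph (graph_join (edgeless S) H)"
  using H S by (auto simp: simple_graph_def graph_join_def edgeless_def nsets_def card_insert_if)

lemma clique_join_edgeless_iff:
  assumes "K \<subseteq> verts H"
  shows "clique K (edges (graph_join (edgeless S) H)) \<longleftrightarrow> clique K (edges H)"
    and "s \<in> S \<Longrightarrow> clique (insert s K) (edges (graph_join (edgeless S) H)) \<longleftrightarrow> clique K (edges H)"
proof -
  show 1: "clique K (edges (graph_join (edgeless S) H)) \<longleftrightarrow> clique K (edges H)"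
    unfolding clique_def using assms edge_join_edgeless_cases(3) by blast
  show "clique (insert s K) (edges (graph_join (edgeless S) H)) \<longleftrightarrow> clique K (edges H)" if "s \<in> S"
    using that assms edge_join_edgeless_cases(2) unfolding clique_insert_iff 1 by blast
qed

lemma clique_join_edgeless_at_most_one:
  assumes "clique K (edges (graph_join (edgeless S) H))" "u \<in> K" "v \<in> K" "u \<in> S" "v \<in> S"
  shows "u = v"
proof (rule ccontr)
  assume "u \<noteq> v"
  with assms(1-3) have "{u, v} \<in> edges (graph_join (edgeless S) H)" by (auto simp: clique_def)
  with assms(4,5) edge_join_edgeless_cases(1) show False by blast
qed

text \<open>\<open>S\<close> is independent in the join, so a clique meets it in at most one vertex;
  what remains is a clique of \<open>H\<close>.\<close>

lemma clique_join_edgeless_cases: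
  assumes "clique K (edges (graph_join (edgeless S) H))" "K \<subseteq> S \<union> verts H"
  obtains "K \<subseteq> verts H" "clique K (edges H)"
  | s where "s \<in> S" "s \<in> K" "K - {s} \<subseteq> verts H" "clique (K - {s}) (edges H)"
proof (cases "K \<inter> S = {}")
  case True
  with assms(2) have "K \<subseteq> verts H" by blast
  with that(1) assms(1) clique_join_edgeless_iff(1) show ?thesis by blast
next
  case False
  then obtain s where s: "s \<in> S" "s \<in> K" by blast
  have "K - {s} \<subseteq> verts H" using assms(2) clique_join_edgeless_at_most_one[OF assms(1)] s by blast
  moreover have "clique (K - {s}) (edges (graph_join (edgeless S) H))"
    using assms(1) by (rule clique_subset) blast
  ultimately show ?thesis using that(2)[OF s] clique_join_edgeless_iff(1) by blast
qed

text \<open>A clique of \<open>H\<close> can be extended by any one vertex of \<open>S\<close>, and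
  a clique of the join loses at most one vertex on restriction to \<open>H\<close>.\<close>

lemma contains_K_join_edgeless_iff:
  assumes "S \<noteq> {}"
  shows "contains_K (Suc k) (graph_join (edgeless S) H) \<longleftrightarrow> contains_K k H"
proof
  assume "contains_K (Suc k) (graph_join (edgeless S) H)"
  then obtain K where K: "K \<subseteq> S \<union> verts H" "finite K" "card K = Suc k"
    "clique K (edges (graph_join (edgeless S) H))"
    unfolding contains_K_iff verts_join_edgeless by blast
  from K(4,1) show "contains_K k H"
  proof (cases rule: clique_join_edgeless_cases)
    case 1
    then show ?thesis using clique_of_smaller_size[of K H k] K(3) by simp
  next
    case (2 s)
    have "card (K - {s}) = k" using K(2,3) 2(2) by simp
    then show ?thesis using clique_of_smaller_size[OF 2(3,4), of k] by simp
  qed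
next
  assume "contains_K k H"
  then obtain K where K: "K \<subseteq> verts H" "finite K" "card K = k" "clique K (edges H)"
    unfolding contains_K_iff by blast
  obtain s where s: "s \<in> S" using assms by blast
  then have "s \<notin> K" using K(1) S(2) by blast
  then have "insert s K \<in> cliques (Suc k) (graph_join (edgeless S) H)"
    using K s clique_join_edgeless_iff(2)[OF K(1) s]
    by (auto simp: in_cliques_iff verts_join_edgeless)
  then show "contains_K (Suc k) (graph_join (edgeless S) H)" by blast
qed

text \<open>A set meeting both \<open>S\<close> and \<open>H\<close> contains an edge of the join,
  so an independent set lies on one side.\<close>

lemma indep_join_edgeless_iff:
  "T \<subseteq> S \<union> verts H \<and> indep T (edges (graph_join (edgeless S) H)) \<longleftrightarrow>
     T \<subseteq> S \<or> T \<subseteq> verts H \<and> indep T (edges H)"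
    (is "?L \<longleftrightarrow> ?R")
proof
  assume L: ?L
  show ?R
  proof (cases "T \<subseteq> S")
    case False
    with L obtain v where v: "v \<in> T" "v \<in> verts H" "v \<notin> S" by blast
    have "w \<in> verts H" if "w \<in> T" for w
    proof (rule ccontr)
      assume "w \<notin> verts H"
      with L that v have "w \<in> S" "w \<noteq> v" by blast+
      with v edge_join_edgeless_cases(2) that L show False unfolding indep_def by blast
    qed
    then have "T \<subseteq> verts H" by blast
    moreover from this L have "indep T (edges H)"
      unfolding indep_def using edge_join_edgeless_cases(3) by blast
    ultimately show ?thesis by blast
  qed blast
next
  assume ?R
  then show ?L
  proof
    assume "T \<subseteq> S"
    then show ?L unfolding indep_def using edge_join_edgeless_cases(1) by blast
  next
    assume "T \<subseteq> verts H \<and> indep T (edges H)"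
    then show ?L unfolding indep_def using edge_join_edgeless_cases(3) by blast
  qed
qed

text \<open>The independence number of the join is the maximum of \<open>card S\<close> and that of
  \<open>H\<close>. Stating this as a bound by an arbitrary \<open>t\<close> also gives lower
  bounds, by taking the number itself for \<open>t\<close>.\<close>

lemma independence_number_join_edgeless_le_iff:
  "\<alpha>\<^sub>G (graph_join (edgeless S) H) \<le> t \<longleftrightarrow> card S \<le> t \<and> \<alpha>\<^sub>G H \<le> t"
proof -
  have fin: "finite (verts H)" "finite (verts (graph_join (edgeless S) H))"
    using H simple_graph_join_edgeless by (simp_all add: simple_graph_def)
  have "\<alpha>\<^sub>G (graph_join (edgeless S) H) \<le> t \<longleftrightarrow>
      (\<forall>T. T \<subseteq> S \<or> T \<subseteq> verts H \<and> indep T (edges H) \<longrightarrow> card T \<le> t)"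
    unfolding independence_number_le_iff[OF fin(2)] verts_join_edgeless
      indep_join_edgeless_iff[symmetric] by blast
  also have "\<dots> \<longleftrightarrow> card S \<le> t \<and> \<alpha>\<^sub>G H \<le> t"
  proof -
    have "(\<forall>T \<subseteq> S. card T \<le> t) \<longleftrightarrow> card S \<le> t"
      using card_mono[OF S(1)] by (meson le_trans order_refl)
    then show ?thesis unfolding independence_number_le_iff[OF fin(1)] by blast
  qed
  finally show ?thesis .
qed

text \<open>The common completion \<open>Q\<close> of a non-edge of \<open>H\<close> must meet
  \<open>S\<close>, since otherwise \<open>insert u Q\<close> would be a \<open>k\<close>-clique of
  \<open>H\<close>. It meets \<open>S\<close> in one vertex only, and removing that vertex gives the
  completion inside \<open>H\<close>.\<close>

lemma plus_K_join_edgelessD: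
  assumes "S \<noteq> {}" "cliques k H = {}" "plus_K (Suc k) (graph_join (edgeless S) H)"
  shows "plus_K k H"
  unfolding plus_K_iff[OF H]
proof (intro ballI impI)
  fix u v assume uv: "u \<in> verts H" "v \<in> verts H" "u \<noteq> v" "{u, v} \<notin> edges H"
  let ?J = "graph_join (edgeless S) H"
  have "u \<in> verts ?J" "v \<in> verts ?J" "{u, v} \<notin> edges ?J"
    using uv S(2) by (auto simp: verts_join_edgeless edge_join_edgeless)
  then obtain Q where Q: "Q \<subseteq> verts ?J" "finite Q" "u \<notin> Q" "v \<notin> Q" "card Q + 2 = Suc k"
      "clique (insert u Q) (edges ?J)" "clique (insert v Q) (edges ?J)"
    using plus_KE[OF simple_graph_join_edgeless assms(3) _ _ uv(3)] by metis
  show "\<exists>Q\<subseteq>verts H. u \<notin> Q \<and> v \<notin> Q \<and> card Q + 2 = k \<and>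
       clique (insert u Q) (edges H) \<and> clique (insert v Q) (edges H)"
  proof (cases "Q \<inter> S = {}")
    case True
    then have 1: "insert u Q \<subseteq> verts H" using Q(1) uv(1) by (auto simp: verts_join_edgeless)
    then have "clique (insert u Q) (edges H)" using Q(6) clique_join_edgeless_iff(1) by blast
    moreover have "card (insert u Q) = k" using Q(2,3,5) by simp
    ultimately have "insert u Q \<in> cliques k H" using 1 Q(2) by (simp add: in_cliques_iff)
    with assms(2) show ?thesis by blast
  next
    case False
    then obtain s where s: "s \<in> Q" "s \<in> S" by blast
    have "Q - {s} \<subseteq> verts H"
      using Q(1) clique_join_edgeless_at_most_one[OF Q(6)] s by (auto simp: verts_join_edgeless)
    moreover have "clique (insert w (Q - {s})) (edges H)"
      if "clique (insert w Q) (edges ?J)" "w \<in> verts H" for w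
    proof -
      have "clique (insert w (Q - {s})) (edges ?J)" using that(1) by (rule clique_subset) blast
      moreover have "insert w (Q - {s}) \<subseteq> verts H"
        using that(2) \<open>Q - {s} \<subseteq> verts H\<close> by blast
      ultimately show ?thesis using clique_join_edgeless_iff(1) by blast
    qed
    moreover have "card (Q - {s}) + 2 = k"
      using s(1) Q(2,5) card_Suc_Diff1[of Q s] by simp
    ultimately show ?thesis using Q uv by (intro exI[of _ "Q - {s}"]) simp
  qed
qed

text \<open>Non-edges of the join lie inside \<open>H\<close> or inside \<open>S\<close>. The former
  are handled by adding a vertex of \<open>S\<close> to the completion in \<open>H\<close>; the
  latter have the \<open>k - 1\<close>-clique of \<open>H\<close> as completion, and the last
  hypothesis provides it whenever \<open>S\<close> has two vertices.\<close>

lemma plus_K_join_edgelessI: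
  assumes "S \<noteq> {}" "plus_K k H" "k > 0" "card S \<le> 1 \<or> contains_K (k - 1) H"
  shows "plus_K (Suc k) (graph_join (edgeless S) H)" (is "plus_K _ ?J")
  unfolding plus_K_iff[OF simple_graph_join_edgeless]
proof (intro ballI impI)
  fix u v assume uv: "u \<in> verts ?J" "v \<in> verts ?J" "u \<noteq> v" "{u, v} \<notin> edges ?J"
  then consider "u \<in> S" "v \<in> S" | "u \<in> verts H" "v \<in> verts H"
    unfolding verts_join_edgeless edge_join_edgeless by blast
  then show "\<exists>Q\<subseteq>verts ?J. u \<notin> Q \<and> v \<notin> Q \<and> card Q + 2 = Suc k \<and>
       clique (insert u Q) (edges ?J) \<and> clique (insert v Q) (edges ?J)"
  proof cases
    case 1
    then have "\<not> card S \<le> 1" using uv(3) S(1) card_le_Suc0_iff_eq[of S] by auto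
    then obtain Q where Q: "Q \<subseteq> verts H" "card Q = k - 1" "clique Q (edges H)"
      using assms(4) unfolding contains_K_iff by blast
    have "u \<notin> Q" "v \<notin> Q" using 1 Q(1) S(2) by blast+
    moreover have "card Q + 2 = Suc k" using Q(2) assms(3) by simp
    moreover have "Q \<subseteq> verts ?J" using Q(1) by (auto simp: verts_join_edgeless)
    ultimately show ?thesis
      using clique_join_edgeless_iff(2)[OF Q(1)] Q(3) 1 by (intro exI[of _ Q]) simp
  next
    case 2
    have nS: "u \<notin> S" "v \<notin> S" using 2 S(2) by blast+
    have "{u, v} \<notin> edges H" using uv(4) unfolding edge_join_edgeless by blast
    with 2 uv(3) obtain Q where Q: "Q \<subseteq> verts H" "finite Q" "u \<notin> Q" "v \<notin> Q" "card Q + 2 = k"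
      "clique (insert u Q) (edges H)" "clique (insert v Q) (edges H)"
      using plus_KE[OF H assms(2)] by metis
    obtain s where s: "s \<in> S" using assms(1) by blast
    then have sQ: "s \<notin> Q" using Q(1) S(2) by blast
    have "clique (insert w (insert s Q)) (edges ?J)"
      if "clique (insert w Q) (edges H)" "w \<in> verts H" for w
      using that clique_join_edgeless_iff(2)[OF _ s, of "insert w Q"] Q(1)
      by (simp add: insert_commute)
    then have "clique (insert u (insert s Q)) (edges ?J)" "clique (insert v (insert s Q)) (edges ?J)"
      using Q(6,7) 2 by blast+
    moreover have "insert s Q \<subseteq> verts ?J" using Q(1) s by (auto simp: verts_join_edgeless)
    moreover have "card (insert s Q) + 2 = Suc k" using sQ Q(2,5) by simp
    moreover have "u \<notin> insert s Q" "v \<notin> insert s Q" using Q(3,4) s nS by auto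
    ultimately show ?thesis by (intro exI[of _ "insert s Q"] conjI)
  qed
qed

end

text \<open>The vertices of \<open>S\<close> are twins and can all be given the color of a single
  vertex \<open>x\<close> of \<open>T\<close>. A monochromatic clique uses at most one of them, and
  \<open>x\<close> can replace it. Only nonemptiness of the new edgeless part matters, not its
  size.\<close>

lemma arrows_join_edgeless:
  assumes H: "simple_graph H" and S: "finite S" "S \<inter> verts H = {}"
    and T: "finite T" "T \<inter> verts H = {}" "T \<noteq> {}"
    and arr: "arrows (graph_join (edgeless S) H) as"
  shows "arrows (graph_join (edgeless T) H) as"
  unfolding arrows_def
proof (intro allI impI)
  let ?J = "graph_join (edgeless S) H" and ?J' = "graph_join (edgeless T) H"
  fix c assume c: "c ` verts ?J' \<subseteq> {..<length as}"
  obtain x where x: "x \<in> T" using T(3) by blast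
  define c' where "c' = (\<lambda>v. if v \<in> S then c x else c v)"
  have "c' ` verts ?J \<subseteq> {..<length as}"
    using c x by (auto simp: c'_def verts_join_edgeless[OF H S] verts_join_edgeless[OF H T(1,2)])
  then obtain i K where K: "i < length as" "K \<in> cliques (as ! i) ?J" "\<forall>v\<in>K. c' v = i"
    by (rule arrowsE[OF arr])
  from K(2) have K': "clique K (edges ?J)" "K \<subseteq> S \<union> verts H" "finite K" "card K = as ! i"
    by (simp_all add: in_cliques_iff verts_join_edgeless[OF H S])
  have "\<exists>L \<in> cliques (as ! i) ?J'. \<forall>v\<in>L. c v = i"
    using clique_join_edgeless_cases[OF H S K'(1,2)]
  proof cases
    case 1
    then have "K \<in> cliques (as ! i) ?J'"
      using K' clique_join_edgeless_iff(1)[OF H T(1,2)]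
      by (auto simp: in_cliques_iff verts_join_edgeless[OF H T(1,2)])
    moreover have "c v = i" if "v \<in> K" for v
    proof -
      have "v \<notin> S" using 1(1) that S(2) by blast
      then show ?thesis using K(3) that by (auto simp: c'_def)
    qed
    ultimately show ?thesis by blast
  next
    case (2 s)
    let ?L = "insert x (K - {s})"
    have "x \<notin> K - {s}" using 2(3) x T(2) by blast
    then have "card ?L = as ! i" using K'(3,4) 2(2) by (metis card.insert card_Suc_Diff1 finite_Diff)
    then have "?L \<in> cliques (as ! i) ?J'"
      using K'(3) 2 x clique_join_edgeless_iff(2)[OF H T(1,2) 2(3) x]
      by (auto simp: in_cliques_iff verts_join_edgeless[OF H T(1,2)])
    moreover have "c x = i" using K(3) 2(1,2) by (auto simp: c'_def)
    moreover have "c v = i" if "v \<in> K - {s}" for v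
    proof -
      have "v \<notin> S" using 2(3) that S(2) by blast
      then show ?thesis using K(3) that by (auto simp: c'_def)
    qed
    ultimately show ?thesis by blast
  qed
  with K(1) show "\<exists>i<length as. \<exists>K\<in>cliques (as ! i) ?J'. \<forall>v\<in>K. c v = i" by blast
qed

text \<open>Glues an isomorphism of the second parts with a bijection of the edgeless parts. This
  makes the names of the vertices added in steps 5 and 6 immaterial.\<close>

lemma graph_join_edgeless_iso:
  assumes "H \<cong>\<^sub>G H'" "finite S" "S \<inter> verts H = {}" "finite S'" "S' \<inter> verts H' = {}" "card S = card S'"
  shows "graph_join (edgeless S) H \<cong>\<^sub>G graph_join (edgeless S') H'" (is "?J \<cong>\<^sub>G ?J'")
proof -
  obtain f where f: "iso_map f H H'" and s: "simple_graph H" "simple_graph H'"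
    using assms(1) by (auto simp: graph_iso_iff)
  obtain g where g: "bij_betw g S S'" using assms(2,4,6) finite_same_card_bij by blast
  have g': "inj_on g S" "g ` S = S'" using g by (auto simp: bij_betw_def)
  define h where "h = (\<lambda>v. if v \<in> S then g v else f v)"
  have hS: "h v = g v" "g v \<in> S'" "g v \<notin> verts H'" if "v \<in> S" for v
    using that g'(2) assms(5) by (auto simp: h_def)
  have hH: "h v = f v" "f v \<in> verts H'" "f v \<notin> S'" if "v \<in> verts H" for v
    using that assms(3,5) iso_mapD(2)[OF f] by (auto simp: h_def)
  note V = verts_join_edgeless[OF s(1) assms(2,3)] verts_join_edgeless[OF s(2) assms(4,5)]
  note E = edge_join_edgeless[OF s(1) assms(2,3)] edge_join_edgeless[OF s(2) assms(4,5)]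
  have "inj_on h (verts ?J)"
  proof (rule inj_onI)
    fix u v assume uv: "u \<in> verts ?J" "v \<in> verts ?J" "h u = h v"
    then consider "u \<in> S" "v \<in> S" | "u \<in> S" "v \<in> verts H" | "u \<in> verts H" "v \<in> S"
      | "u \<in> verts H" "v \<in> verts H" unfolding V by blast
    then show "u = v"
    proof cases
      case 1 with uv(3) show ?thesis using inj_onD[OF g'(1)] by (simp add: hS)
    next
      case 2 with uv(3) hS[of u] hH[of v] show ?thesis by simp
    next
      case 3 with uv(3) hS[of v] hH[of u] show ?thesis by simp
    next
      case 4 with uv(3) show ?thesis using inj_onD[OF iso_mapD(1)[OF f]] by (simp add: hH)
    qed
  qed
  moreover have "verts ?J' = h ` verts ?J"
  proof -
    have "h ` S = S'" using g'(2) hS(1) by force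
    moreover have "h ` verts H = verts H'" using iso_mapD(2)[OF f] hH(1) by force
    ultimately show ?thesis unfolding V by blast
  qed
  moreover have "{h u, h v} \<in> edges ?J' \<longleftrightarrow> {u, v} \<in> edges ?J"
    if uv: "u \<in> verts ?J" "v \<in> verts ?J" for u v
  proof -
    from uv consider "u \<in> S" "v \<in> S" | "u \<in> S" "v \<in> verts H" | "u \<in> verts H" "v \<in> S"
      | "u \<in> verts H" "v \<in> verts H" unfolding V by blast
    then show ?thesis
    proof cases
      case 1
      then have "u \<notin> verts H" "v \<notin> verts H" using assms(3) by blast+
      with 1 hS[of u] hS[of v] show ?thesis
        unfolding E using edge_in_simple_graph[OF s(1)] edge_in_simple_graph[OF s(2)] by auto
    next
      case 2 with hS[of u] hH[of v] show ?thesis unfolding E by auto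
    next
      case 3 with hS[of v] hH[of u] show ?thesis unfolding E by auto
    next
      case 4
      then have "u \<notin> S" "v \<notin> S" using assms(3) by blast+
      with 4 hH[of u] hH[of v] iso_mapD(3)[OF f, of u v] show ?thesis unfolding E by auto
    qed
  qed
  ultimately have "iso_map h ?J ?J'" unfolding iso_map_def by blast
  then show ?thesis
    using simple_graph_join_edgeless[OF s(1) assms(2,3)] simple_graph_join_edgeless[OF s(2) assms(4,5)]
    unfolding graph_iso_iff by blast
qed

text \<open>The last hypothesis says that every vertex of \<open>S\<close> has neighbourhood
  \<open>verts G - S\<close>. It is applied to a single cone vertex and to the class of twins that
  arises in step 5.\<close>

lemma delete_verts_join_edgeless:
  assumes "simple_graph G" "S \<subseteq> verts G"
    "\<And>s v. s \<in> S \<Longrightarrow> v \<in> verts G \<Longrightarrow> {s, v} \<in> edges G \<longleftrightarrow> v \<notin> S"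
  shows "graph_join (edgeless S) (delete_verts G S) = G"
proof (rule simple_graph_eqI)
  have fin: "finite S" "S \<inter> verts (delete_verts G S) = {}"
    using assms(1,2) finite_subset by (auto simp: simple_graph_def)
  have D: "simple_graph (delete_verts G S)" using assms(1) by (rule simple_graph_delete_verts)
  show "simple_graph (graph_join (edgeless S) (delete_verts G S))"
    using D fin by (rule simple_graph_join_edgeless)
  show "verts (graph_join (edgeless S) (delete_verts G S)) = verts G"
    using assms(2) by (auto simp: verts_join_edgeless[OF D fin])
  show "{u, v} \<in> edges (graph_join (edgeless S) (delete_verts G S)) \<longleftrightarrow> {u, v} \<in> edges G" for u v
    unfolding edge_join_edgeless[OF D fin] edge_delete_verts[OF assms(1)] verts_delete_verts
    using assms(2) assms(3)[of u v] assms(3)[of v u] edge_in_simple_graph[OF assms(1), of u v]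
    by (auto simp: insert_commute)
qed (rule assms(1))

lemma cone_vertex_join:
  assumes "simple_graph G" "cone_vertex G c"
  shows "graph_join (edgeless {c}) (delete_verts G {c}) = G"
proof (rule delete_verts_join_edgeless[OF assms(1)])
  show "{c} \<subseteq> verts G" using assms(2) by (simp add: cone_vertex_def)
  show "{s, v} \<in> edges G \<longleftrightarrow> v \<notin> {c}" if "s \<in> {c}" "v \<in> verts G" for s v
    using that assms(2) edge_in_simple_graph(3)[OF assms(1), of c c]
    unfolding cone_vertex_def by (cases "v = c") auto
qed

lemma delete_vert_iso:
  assumes "iso_map f G H" "simple_graph G" "simple_graph H" "c \<in> verts G"
  shows "delete_verts G {c} \<cong>\<^sub>G delete_verts H {f c}"
proof -
  have 1: "f v \<noteq> f c" if "v \<in> verts G" "v \<noteq> c" for v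
    using inj_onD[OF iso_mapD(1)[OF assms(1)]] that assms(4) by blast
  have "inj_on f (verts G - {c})" using iso_mapD(1)[OF assms(1)] by (rule inj_on_subset) blast
  moreover have "verts H - {f c} = f ` (verts G - {c})"
    using inj_on_image_set_diff[OF iso_mapD(1)[OF assms(1)], of "verts G" "{c}"] assms(4)
      iso_mapD(2)[OF assms(1)] by simp
  moreover have "{f u, f v} \<in> edges (delete_verts H {f c}) \<longleftrightarrow> {u, v} \<in> edges (delete_verts G {c})"
    if "u \<in> verts G - {c}" "v \<in> verts G - {c}" for u v
    using that 1[of u] 1[of v] iso_mapD(3)[OF assms(1), of u v]
    by (simp add: edge_delete_verts[OF assms(2)] edge_delete_verts[OF assms(3)])
  ultimately have "iso_map f (delete_verts G {c}) (delete_verts H {f c})"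
    unfolding iso_map_def verts_delete_verts by blast
  then show ?thesis
    using simple_graph_delete_verts[OF assms(2)] simple_graph_delete_verts[OF assms(3)]
    unfolding graph_iso_iff by blast
qed

section \<open>Deleting independent sets and adding vertices\<close>

lemma clique_indep_eq:
  "clique K E \<Longrightarrow> indep S E \<Longrightarrow> u \<in> K \<Longrightarrow> v \<in> K \<Longrightarrow> u \<in> S \<Longrightarrow> v \<in> S \<Longrightarrow> u = v"
  unfolding clique_def indep_def by blast

lemma in_cliques_delete_verts_iff:
  "K \<in> cliques k (delete_verts G X) \<longleftrightarrow> K \<in> cliques k G \<and> K \<inter> X = {}"
proof -
  have "K \<in> cliques k G \<Longrightarrow> K \<subseteq> verts G" by (simp add: in_cliques_iff)
  then show ?thesis unfolding delete_verts_def cliques_induced by blast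
qed

lemma delete_verts_delete_verts:
  assumes "simple_graph G"
  shows "delete_verts (delete_verts G X) Y = delete_verts G (X \<union> Y)"
  by (rule simple_graph_eqI)
    (use assms in \<open>auto simp: edge_delete_verts simple_graph_delete_verts\<close>)

lemma independence_number_delete_verts_le:
  assumes "simple_graph G" "\<alpha>\<^sub>G G \<le> t"
  shows "\<alpha>\<^sub>G (delete_verts G X) \<le> t"
proof -
  have fin: "finite (verts G)" "finite (verts (delete_verts G X))"
    using assms(1) by (simp_all add: simple_graph_def)
  show ?thesis
    unfolding independence_number_le_iff[OF fin(2)]
  proof (intro allI impI)
    fix S assume S: "S \<subseteq> verts (delete_verts G X)" "indep S (edges (delete_verts G X))"
    then have "S \<subseteq> verts G - X" by simp
    with S indep_delete_verts_iff[OF this] have "S \<subseteq> verts G" "indep S (edges G)" by blast+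
    with assms(2) show "card S \<le> t" unfolding independence_number_le_iff[OF fin(1)] by blast
  qed
qed

text \<open>A coloring of \<open>G - S\<close> is extended by giving \<open>S\<close> the first
  color. A clique of that color has at most one vertex in the independent set \<open>S\<close>,
  hence the drop from \<open>a\<close> to \<open>a - 1\<close>; cliques of the other colors avoid
  \<open>S\<close>.\<close>

lemma arrows_delete_indep:
  assumes "indep S (edges G)" "arrows G (a # as)"
  shows "arrows (delete_verts G S) ((a - 1) # as)"
  unfolding arrows_def
proof (intro allI impI)
  let ?H = "delete_verts G S"
  fix c assume c: "c ` verts ?H \<subseteq> {..<length ((a - 1) # as)}"
  define c' where "c' = (\<lambda>v. if v \<in> S then 0 else c v)"
  have "c' ` verts G \<subseteq> {..<length (a # as)}"
    using c by (auto simp: c'_def)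
  then obtain i K where i: "i < length (a # as)" and K: "K \<in> cliques ((a # as) ! i) G"
    and col: "\<forall>v\<in>K. c' v = i"
    by (rule arrowsE[OF assms(2)])
  have "\<exists>L \<in> cliques (((a - 1) # as) ! i) ?H. \<forall>v\<in>L. c v = i"
  proof (cases i)
    case 0
    have K': "K \<subseteq> verts G" "finite K" "card K = a" "clique K (edges G)"
      using K 0 by (simp_all add: in_cliques_iff)
    have "card (K \<inter> S) \<le> 1"
      using clique_indep_eq[OF K'(4) assms(1)] K'(2) card_le_Suc0_iff_eq[of "K \<inter> S"] by auto
    then have "a - 1 \<le> card (K - S)" using card_Diff_subset_Int[of K S] K'(2,3) by simp
    \<comment> \<open>\<open>K - S\<close> may still have all \<open>a\<close> vertices, so a subset
      of the exact size is chosen.\<close>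
    then obtain L where L: "L \<subseteq> K - S" "finite L" "card L = a - 1"
      by (meson obtain_subset_with_card_n)
    then have "clique L (edges G)" using clique_subset[OF K'(4)] by blast
    with L K'(1) have "L \<in> cliques (a - 1) G" "L \<inter> S = {}" by (auto simp: in_cliques_iff)
    then have "L \<in> cliques (((a - 1) # as) ! i) ?H" using 0 by (simp add: in_cliques_delete_verts_iff)
    moreover have "c v = i" if "v \<in> L" for v
    proof -
      have "v \<in> K" "v \<notin> S" using that L(1) by blast+
      then show ?thesis using col by (auto simp: c'_def)
    qed
    ultimately show ?thesis by blast
  next
    case (Suc j)
    have "v \<notin> S \<and> c v = i" if "v \<in> K" for v
      using bspec[OF col that] Suc by (cases "v \<in> S") (simp_all add: c'_def)
    then show ?thesis using K Suc in_cliques_delete_verts_iff[of K _ G S] by (intro bexI[of _ K]) auto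
  qed
  with i show "\<exists>i<length ((a - 1) # as). \<exists>K\<in>cliques (((a - 1) # as) ! i) ?H. \<forall>v\<in>K. c v = i"
    by auto
qed

text \<open>A completion \<open>Q\<close> in \<open>G\<close> has \<open>q - 2\<close> vertices, of
  which at most one lies in \<open>S\<close>. Dropping one vertex puts it into \<open>G - S\<close>
  and lowers the clique size by one.\<close>

lemma plus_K_delete_indep:
  assumes "simple_graph G" "plus_K q G" "q \<ge> 3" "indep S (edges G)"
  shows "plus_K (q - 1) (delete_verts G S)" (is "plus_K _ ?H")
  unfolding plus_K_iff[OF simple_graph_delete_verts[OF assms(1)]]
proof (intro ballI impI)
  fix u v assume "u \<in> verts ?H" "v \<in> verts ?H" and "u \<noteq> v" and e: "{u, v} \<notin> edges ?H"
  then have uv: "u \<in> verts G" "u \<notin> S" "v \<in> verts G" "v \<notin> S" by auto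
  with e have "{u, v} \<notin> edges G" by (simp add: edge_delete_verts[OF assms(1)])
  with uv \<open>u \<noteq> v\<close> obtain Q where Q: "Q \<subseteq> verts G" "finite Q" "u \<notin> Q" "v \<notin> Q" "card Q + 2 = q"
      "clique (insert u Q) (edges G)" "clique (insert v Q) (edges G)"
    using plus_KE[OF assms(1,2)] by metis
  have "Q \<noteq> {}" using Q(5) assms(3) by auto
  \<comment> \<open>The vertex to drop is the one in \<open>S\<close>, or any vertex of
    \<open>Q\<close> if \<open>Q\<close> avoids \<open>S\<close>; \<open>q \<ge> 3\<close> ensures
    that there is one.\<close>
  have "\<exists>x\<in>Q. (Q - {x}) \<inter> S = {}"
  proof (cases "Q \<inter> S = {}")
    case True
    then show ?thesis using \<open>Q \<noteq> {}\<close> by blast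
  next
    case False
    then show ?thesis using clique_indep_eq[OF Q(6) assms(4)] by blast
  qed
  then obtain x where x: "x \<in> Q" "(Q - {x}) \<inter> S = {}" by blast
  have "clique (insert w (Q - {x})) (edges ?H)"
    if "clique (insert w Q) (edges G)" "w \<in> verts G" "w \<notin> S" for w
  proof -
    have "insert w (Q - {x}) \<subseteq> verts G - S" using that(2,3) Q(1) x(2) by blast
    moreover have "clique (insert w (Q - {x})) (edges G)"
      using that(1) by (rule clique_subset) blast
    ultimately show ?thesis using clique_delete_verts_iff by blast
  qed
  then have "clique (insert u (Q - {x})) (edges ?H)" "clique (insert v (Q - {x})) (edges ?H)"
    using Q(6,7) uv by blast+
  moreover have "Q - {x} \<subseteq> verts ?H" using Q(1) x(2) by auto
  moreover have "card (Q - {x}) + 2 = q - 1" using x(1) Q(2,5) card_Suc_Diff1[of Q x] by simp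
  ultimately show "\<exists>Q\<subseteq>verts ?H. u \<notin> Q \<and> v \<notin> Q \<and> card Q + 2 = q - 1 \<and>
       clique (insert u Q) (edges ?H) \<and> clique (insert v Q) (edges ?H)"
    using Q(3,4) by (intro exI[of _ "Q - {x}"]) simp
qed

section \<open>Adding edges up to maximality\<close>

lemma arrows_more_edges:
  assumes "arrows (V, E) as" "E \<subseteq> E'"
  shows "arrows (V, E') as"
proof -
  have "cliques k (V, E) \<subseteq> cliques k (V, E')" for k
    using assms(2) unfolding cliques_def clique_def by auto
  then show ?thesis using assms(1) unfolding arrows_def by (metis fst_conv subsetD)
qed

lemma independence_number_more_edges:
  assumes "finite V" "\<alpha>\<^sub>G (V, E) \<le> t" "E \<subseteq> E'"
  shows "\<alpha>\<^sub>G (V, E') \<le> t"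
proof -
  have "indep S E" if "indep S E'" for S using that assms(3) unfolding indep_def by blast
  with assms(1,2) show ?thesis by (simp add: independence_number_le_iff)
qed

text \<open>Among the finitely many edge sets without \<open>q\<close>-clique that contain
  \<open>E\<close>, take a maximal one. Any further edge creates a \<open>q\<close>-clique, which is
  new because there was none before.\<close>

lemma maximal_K_free_supergraph:
  assumes "simple_graph (V, E)" "cliques q (V, E) = {}"
  obtains E' where "E \<subseteq> E'" "simple_graph (V, E')" "cliques q (V, E') = {}" "plus_K q (V, E')"
proof -
  define F where "F = {E'. E' \<subseteq> [V]\<^bsup>2\<^esup> \<and> cliques q (V, E') = {}}"
  have V: "finite V" and "E \<in> F" using assms by (simp_all add: F_def simple_graph_def)
  have "finite F"
  proof (rule finite_subset)
    show "F \<subseteq> Pow (Pow V)" by (auto simp: F_def nsets_def)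
  qed (use V in simp)
  from finite_has_maximal2[OF this \<open>E \<in> F\<close>]
  obtain E' where E': "E' \<in> F" "E \<subseteq> E'" and max: "\<forall>B\<in>F. E' \<subseteq> B \<longrightarrow> E' = B" by auto
  have "plus_K q (V, E')" unfolding plus_K_def
  proof
    fix e assume "e \<in> complement_edges (V, E')"
    then have e: "e \<in> [V]\<^bsup>2\<^esup>" "e \<notin> E'" by (simp_all add: complement_edges_def)
    then have "insert e E' \<notin> F" using max by blast
    then have "cliques q (V, insert e E') \<noteq> {}" using e(1) E'(1) by (auto simp: F_def)
    moreover have "cliques q (V, E') = {}" using E'(1) by (simp add: F_def)
    ultimately show "\<exists>K. K \<in> cliques q (add_edge (V, E') e) \<and> K \<notin> cliques q (V, E')"
      by (auto simp: add_edge_def)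
  qed
  moreover have "simple_graph (V, E')" "cliques q (V, E') = {}"
    using E'(1) V by (simp_all add: F_def simple_graph_def)
  ultimately show thesis using that E'(2) by blast
qed

lemma obtained_from_maximal:
  fixes H :: "'v graph"
  assumes "\<A> \<approx>\<^sub>G (\<H>_max t as q n :: 'v graph set)" "H \<in> \<H>_plus t k as q n"
  shows "\<exists>G\<in>\<A>. obtained_by_removing_edges H G"
proof -
  obtain V E where VE: "H = (V, E)" by (cases H)
  have H: "simple_graph (V, E)" "card V = n" "arrows (V, E) as" "cliques q (V, E) = {}"
    "\<alpha>\<^sub>G (V, E) \<le> t"
    using assms(2) by (simp_all add: in_\<H>_plus_iff VE)
  obtain E' where E': "E \<subseteq> E'" "simple_graph (V, E')" "cliques q (V, E') = {}" "plus_K q (V, E')"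
    by (rule maximal_K_free_supergraph[OF H(1,4)])
  have "finite V" using H(1) by (simp add: simple_graph_def)
  then have "(V, E') \<in> \<H>_max t as q n"
    using E' H(2) arrows_more_edges[OF H(3) E'(1)] independence_number_more_edges[OF _ H(5) E'(1)]
    by (simp add: in_\<H>_plus_iff \<H>_max_def)
  then obtain G where G: "G \<in> \<A>" "G \<cong>\<^sub>G (V, E')" using assms(1) unfolding coincide_def by blast
  then obtain f where f: "iso_map f (V, E') G" and sG: "simple_graph G"
    using graph_iso_sym[OF G(2)] by (auto simp: graph_iso_iff)
  \<comment> \<open>The removed edges are those of the copy \<open>G\<close> that are not images of
    edges of \<open>H\<close>.\<close>
  define R where "R = edges G - (`) f ` E"
  have EV: "E \<subseteq> Pow V" using H(1) by (auto simp: simple_graph_def nsets_def)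
  have inj: "inj_on ((`) f) (Pow V)" using iso_mapD(1)[OF f] by (simp add: inj_on_image_Pow)
  have "iso_map f (V, E) (verts G, edges G - R)"
    unfolding iso_map_def
  proof (intro conjI ballI)
    fix u v assume uv: "u \<in> verts (V, E)" "v \<in> verts (V, E)"
    have "{f u, f v} \<in> (`) f ` E \<longleftrightarrow> {u, v} \<in> E"
      using inj_on_image_mem_iff[OF inj _ EV, of "{u, v}"] uv by simp
    moreover have "{f u, f v} \<in> edges G \<longleftrightarrow> {u, v} \<in> E'" using iso_mapD(3)[OF f, of u v] uv by simp
    ultimately show "{f u, f v} \<in> edges (verts G, edges G - R) \<longleftrightarrow> {u, v} \<in> edges (V, E)"
      using E'(1) by (auto simp: R_def)
  qed (use iso_mapD(1,2)[OF f] in simp_all)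
  moreover have "simple_graph (verts G, edges G - R)" using sG by (auto simp: simple_graph_def)
  ultimately have "H \<cong>\<^sub>G (verts G, edges G - R)" using H(1) VE unfolding graph_iso_iff by blast
  moreover have "R \<subseteq> edges G" by (simp add: R_def)
  ultimately show ?thesis using G(1) unfolding obtained_by_removing_edges_def by blast
qed

text \<open>A submultiset of \<open>mset_set S\<close> has multiplicities at most one and so is a
  set. Conditions on submultisets of \<open>N\<close> thus become conditions on subsets of the new
  vertices, even if several vertices share a neighbourhood.\<close>

lemma subseteq_image_mset_setE:
  assumes "finite S" "N \<subseteq># image_mset f (mset_set S)"
  obtains S' where "S' \<subseteq> S" "N = image_mset f (mset_set S')"
proof -
  obtain N' where "image_mset f (mset_set S) = N + N'"
    using assms(2) by (auto simp: subset_mset.le_iff_add)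
  from image_mset_eq_plusD[OF this] obtain B C where B: "mset_set S = B + C" "N = image_mset f B"
    by blast
  have sub: "B \<subseteq># mset_set S" using B(1) by simp
  have "B = mset_set (set_mset B)"
  proof (rule multiset_eqI)
    fix x
    have "count B x \<le> count (mset_set S) x" using sub by (rule mset_subset_eq_count)
    also have "\<dots> \<le> 1" by (simp add: count_mset_set')
    finally have le: "count B x \<le> 1" .
    show "count B x = count (mset_set (set_mset B)) x"
    proof (cases "x \<in># B")
      case True
      then have "count B x \<noteq> 0" by simp
      with le have "count B x = 1" by linarith
      with True show ?thesis by (simp add: count_mset_set')
    next
      case False
      then show ?thesis by (simp add: count_mset_set' not_in_iff)
    qed
  qed
  moreover have "set_mset B \<subseteq> S" using set_mset_mono[OF sub] assms(1) by simp
  ultimately show thesis using that B(2) by metis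
qed

text \<open>Replaces the two parallel lists by the set \<open>S\<close> of new vertices and a
  function \<open>nb\<close> giving their neighbourhoods in \<open>H\<close>, so that no indices
  occur in later arguments.\<close>

lemma is_extension_iff:
  "is_extension H N G \<longleftrightarrow> (\<exists>S nb. finite S \<and> S \<inter> verts H = {} \<and> N = image_mset nb (mset_set S) \<and>
     G = (verts H \<union> S, edges H \<union> {{v, u} | v u. v \<in> S \<and> u \<in> nb v}))"
proof
  assume "is_extension H N G"
  then obtain Ms vs where *: "mset Ms = N" "length vs = length Ms" "distinct vs"
    "set vs \<inter> verts H = {}"
    "G = (verts H \<union> set vs, edges H \<union> {{vs ! j, u} | j u. j < length vs \<and> u \<in> Ms ! j})"
    unfolding is_extension_def by blast
  \<comment> \<open>Since \<open>vs\<close> is distinct, the pairing of \<open>vs\<close> with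
    \<open>Ms\<close> is a finite map.\<close>
  define nb where "nb = (\<lambda>v. the (map_of (zip vs Ms) v))"
  have nb: "nb (vs ! j) = Ms ! j" if "j < length vs" for j
    using that *(2,3) by (simp add: nb_def map_of_zip_nth)
  then have "map nb vs = Ms" using *(2) by (intro nth_equalityI) auto
  then have "N = image_mset nb (mset_set (set vs))"
    using *(1,3) by (metis mset_map mset_set_set)
  moreover have "{{vs ! j, u} | j u. j < length vs \<and> u \<in> Ms ! j} = {{v, u} | v u. v \<in> set vs \<and> u \<in> nb v}"
    (is "?A = ?B")
  proof
    show "?A \<subseteq> ?B"
    proof
      fix e assume "e \<in> ?A"
      then obtain j u where "e = {vs ! j, u}" "j < length vs" "u \<in> Ms ! j" by blast
      with nb[of j] nth_mem[of j vs] show "e \<in> ?B" by blast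
    qed
    show "?B \<subseteq> ?A"
    proof
      fix e assume "e \<in> ?B"
      then obtain v u where e: "e = {v, u}" "v \<in> set vs" "u \<in> nb v" by blast
      then obtain j where "j < length vs" "v = vs ! j" by (auto simp: in_set_conv_nth)
      with e nb[of j] show "e \<in> ?A" by blast
    qed
  qed
  ultimately show "\<exists>S nb. finite S \<and> S \<inter> verts H = {} \<and> N = image_mset nb (mset_set S) \<and>
     G = (verts H \<union> S, edges H \<union> {{v, u} | v u. v \<in> S \<and> u \<in> nb v})"
    using *(4,5) by (intro exI[of _ "set vs"] exI[of _ nb]) simp
next
  assume "\<exists>S nb. finite S \<and> S \<inter> verts H = {} \<and> N = image_mset nb (mset_set S) \<and>
     G = (verts H \<union> S, edges H \<union> {{v, u} | v u. v \<in> S \<and> u \<in> nb v})"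
  then obtain S nb where *: "finite S" "S \<inter> verts H = {}" "N = image_mset nb (mset_set S)"
     "G = (verts H \<union> S, edges H \<union> {{v, u} | v u. v \<in> S \<and> u \<in> nb v})" by blast
  obtain vs where vs: "set vs = S" "distinct vs" using finite_distinct_list[OF *(1)] by blast
  have "mset (map nb vs) = N" using *(3) vs by (metis mset_map mset_set_set)
  moreover have "{{vs ! j, u} | j u. j < length vs \<and> u \<in> map nb vs ! j} = {{v, u} | v u. v \<in> S \<and> u \<in> nb v}"
    (is "?A = ?B")
  proof
    show "?A \<subseteq> ?B"
    proof
      fix e assume "e \<in> ?A"
      then obtain j u where "e = {vs ! j, u}" "j < length vs" "u \<in> nb (vs ! j)" by auto
      with nth_mem[of j vs] vs(1) show "e \<in> ?B" by blast
    qed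
    show "?B \<subseteq> ?A"
    proof
      fix e assume "e \<in> ?B"
      then obtain v u where e: "e = {v, u}" "v \<in> set vs" "u \<in> nb v" using vs(1) by blast
      then obtain j where j: "j < length vs" "v = vs ! j" by (auto simp: in_set_conv_nth)
      then have "u \<in> map nb vs ! j" using e(3) by simp
      with e(1) j show "e \<in> ?A" by blast
    qed
  qed
  ultimately show "is_extension H N G"
    unfolding is_extension_def using * vs by (intro exI[of _ "map nb vs"] exI[of _ vs]) simp
qed

section \<open>Step 2\<close>

text \<open>A clique of size \<open>q + 1\<close> created by one edge would still contain a
  \<open>q\<close>-clique of \<open>G\<close> after dropping an end of that edge. This matches
  \<open>plus_K\<close> with the test performed in step 2.\<close>

lemma clique_number_add_edge:
  assumes "simple_graph G" "cliques q G = {}" "plus_K q G" "e \<in> complement_edges G"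
  shows "\<omega>\<^sub>G (add_edge G e) = q"
proof -
  have fin: "finite (verts (add_edge G e))" using assms(1) by (simp add: add_edge_def simple_graph_def)
  have "contains_K q (add_edge G e)" using assms(3,4) unfolding plus_K_def by blast
  moreover have "cliques (Suc q) (add_edge G e) = {}"
  proof (rule ccontr)
    assume "\<not> ?thesis"
    then obtain K where K: "K \<subseteq> verts G" "finite K" "card K = Suc q" "clique K (insert e (edges G))"
      unfolding contains_K_iff add_edge_def by auto
    have "e \<in> [verts G]\<^bsup>2\<^esup>" using assms(4) by (simp add: complement_edges_def)
    then obtain u v where e: "e = {u, v}" "u \<noteq> v" by (rule nsets2_E)
    have "clique (K - {u}) (edges G)"
      using K(4) unfolding e(1) clique_def by (auto simp: doubleton_eq_iff)
    moreover have "q \<le> card (K - {u})" using K(2,3) by (simp add: card_Diff_singleton_if)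
    ultimately have "contains_K q G" using clique_of_smaller_size[of "K - {u}" G q] K(1) by blast
    with assms(2) show False by blast
  qed
  ultimately show ?thesis
    using clique_number_less_iff[OF fin, of q] clique_number_less_iff[OF fin, of "Suc q"] by auto
qed

text \<open>Clique-freeness comes from the members of \<open>N\<close> being
  \<open>K_(q-1)\<close>-free, \<open>plus_K\<close> from the test in step 2, the upper bound on the
  independence number from condition (b), and the lower bound from the \<open>r\<close> new
  vertices.\<close>

lemma step2_sound:
  assumes H: "H \<in> \<H>_plus t k as' q (n - r)" "n \<ge> r"
    and N: "admissible q r t H N" and ext: "is_extension H N G"
    and max: "\<forall>e \<in> complement_edges G. \<omega>\<^sub>G (add_edge G e) = q"
    and arr: "arrows G as"
  shows "G \<in> \<H>_max t as q n \<and> \<alpha>\<^sub>G G \<ge> r"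
proof -
  have sH: "simple_graph H" and cH: "card (verts H) = n - r" and qH: "cliques q H = {}"
    using H(1) by (simp_all add: in_\<H>_plus_iff)
  have NH: "set_mset N \<subseteq> Pow (verts H)" using N by (auto simp: admissible_def max_K_free_sets_def)
  have sG: "simple_graph G" using simple_graph_extension[OF sH NH ext] .
  from ext obtain S nb where S: "finite S" "S \<inter> verts H = {}" and nb: "N = image_mset nb (mset_set S)"
    and G: "G = (verts H \<union> S, edges H \<union> {{v, u} | v u. v \<in> S \<and> u \<in> nb v})"
    unfolding is_extension_iff by blast
  have nbH: "nb v \<subseteq> verts H" if "v \<in> S" for v
    using NH that S(1) unfolding nb by auto
  have finG: "finite (verts G)" and finH: "finite (verts H)"
    using sG sH by (simp_all add: simple_graph_def)
  have "size N = r" using N by (simp add: admissible_def)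
  then have cS: "card S = r" by (simp add: nb)
  have VG: "verts G = verts H \<union> S" by (simp add: G)
  have EH: "{u, v} \<in> edges G \<longleftrightarrow> {u, v} \<in> edges H" if "u \<in> verts H" "v \<in> verts H" for u v
    using that S(2) by (auto simp: G doubleton_eq_iff)
  have ES: "{u, v} \<notin> edges G" if "u \<in> S" "v \<in> S" for u v
  proof
    assume "{u, v} \<in> edges G"
    then consider "{u, v} \<in> edges H" | "v \<in> nb u" | "u \<in> nb v" by (auto simp: G doubleton_eq_iff)
    then show False
      using that nbH[of u] nbH[of v] S(2) edge_in_simple_graph(1)[OF sH, of u v] by cases blast+
  qed
  have ESH: "{u, v} \<in> edges G \<longleftrightarrow> v \<in> nb u" if "u \<in> S" "v \<in> verts H" for u v
    using that S(2) edge_in_simple_graph(1)[OF sH, of u v] by (auto simp: G doubleton_eq_iff)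
  have clH: "clique K (edges H)" if "K \<subseteq> verts H" "clique K (edges G)" for K
    unfolding clique_def
  proof (intro ballI impI)
    fix u v assume uv: "u \<in> K" "v \<in> K" "u \<noteq> v"
    then have "{u, v} \<in> edges G" by (rule cliqueD[OF that(2)])
    with EH[of u v] uv that(1) show "{u, v} \<in> edges H" by blast
  qed
  have "cliques q G = {}"
  proof (rule ccontr)
    assume "\<not> ?thesis"
    then obtain K where K: "K \<subseteq> verts G" "finite K" "card K = q" "clique K (edges G)"
      unfolding contains_K_iff by blast
    show False
    proof (cases "K \<inter> S = {}")
      case True
      then have "K \<subseteq> verts H" using K(1) VG by blast
      then have "K \<in> cliques q H" using clH K by (simp add: in_cliques_iff)
      with qH show False by blast
    next
      case False
      then obtain v where v: "v \<in> K" "v \<in> S" by blast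
      have adj: "{v, u} \<in> edges G" if "u \<in> K - {v}" for u
        using that cliqueD[OF K(4) v(1), of u] by auto
      have "u \<in> verts H \<and> u \<in> nb v" if u: "u \<in> K - {v}" for u
      proof -
        have "u \<notin> S" using ES[OF v(2), of u] adj[OF u] by auto
        then have "u \<in> verts H" using u K(1) VG by blast
        then show ?thesis using ESH[OF v(2)] adj[OF u] by simp
      qed
      then have 1: "K - {v} \<subseteq> verts H" and 2: "K - {v} \<subseteq> nb v" by blast+
      have "clique (K - {v}) (edges H)" using clH[OF 1] clique_subset[OF K(4)] by blast
      then have "K - {v} \<in> cliques (q - 1) (induced H (nb v))"
        using 1 2 K(2,3) v(1) by (simp add: cliques_induced in_cliques_iff)
      moreover have "nb v \<in> max_K_free_sets (q - 1) H"
        using N v(2) S(1) by (auto simp: admissible_def nb)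
      ultimately show False unfolding max_K_free_sets_def by blast
    qed
  qed
  moreover have "plus_K q G"
    unfolding plus_K_def
  proof
    fix e assume "e \<in> complement_edges G"
    with max have "\<omega>\<^sub>G (add_edge G e) = q" by blast
    moreover have "finite (verts (add_edge G e))" using finG by (simp add: add_edge_def)
    ultimately have "contains_K q (add_edge G e)"
      using clique_number_less_iff[of "add_edge G e" q] by simp
    with \<open>cliques q G = {}\<close> show "\<exists>K. K \<in> cliques q (add_edge G e) \<and> K \<notin> cliques q G" by blast
  qed
  moreover have "card (verts G) = n"
    using H(2) cH cS S finH card_Un_disjoint[of "verts H" S] by (simp add: VG Int_commute)
  moreover have "\<alpha>\<^sub>G G \<le> t"
    unfolding independence_number_le_iff[OF finG]
  proof (intro allI impI)
    fix T assume T: "T \<subseteq> verts G" "indep T (edges G)"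
    \<comment> \<open>The neighbourhoods of the new vertices in \<open>T\<close>, counted with
      multiplicity, so that \<open>size N'\<close> equals
      \<open>card (T \<inter> S)\<close>.\<close>
    define N' where "N' = image_mset nb (mset_set (T \<inter> S))"
    have "N' \<subseteq># N" unfolding N'_def nb using S(1) by (intro image_mset_subseteq_mono) simp
    then have 1: "\<alpha>\<^sub>G (delete_verts H (\<Union> (set_mset N'))) + size N' \<le> t"
      using N unfolding admissible_def by blast
    have "set_mset N' = nb ` (T \<inter> S)" using S(1) by (simp add: N'_def)
    moreover have "u \<notin> nb v" if "u \<in> T \<inter> verts H" "v \<in> T \<inter> S" for u v
    proof -
      have "v \<noteq> u" using that S(2) by blast
      then have "{v, u} \<notin> edges G" using indepD[OF T(2)] that by simp
      then show ?thesis using ESH that by simp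
    qed
    ultimately have TH: "T \<inter> verts H \<subseteq> verts H - \<Union> (set_mset N')" by blast
    have "indep (T \<inter> verts H) (edges H)"
      unfolding indep_def
    proof (intro ballI impI)
      fix u v assume uv: "u \<in> T \<inter> verts H" "v \<in> T \<inter> verts H" "u \<noteq> v"
      then have "{u, v} \<notin> edges G" by (intro indepD[OF T(2)]) blast+
      with EH[of u v] uv show "{u, v} \<notin> edges H" by blast
    qed
    then have "indep (T \<inter> verts H) (edges (delete_verts H (\<Union> (set_mset N'))))"
      using indep_delete_verts_iff[OF TH] by blast
    moreover have "finite (verts (delete_verts H (\<Union> (set_mset N'))))" using finH by simp
    ultimately have "card (T \<inter> verts H) \<le> \<alpha>\<^sub>G (delete_verts H (\<Union> (set_mset N')))"
      using independence_number_le_iff[of "delete_verts H (\<Union> (set_mset N'))"] TH by auto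
    moreover have "card T \<le> card (T \<inter> verts H) + card (T \<inter> S)"
    proof -
      have "T = (T \<inter> verts H) \<union> (T \<inter> S)" using T(1) VG by blast
      then show ?thesis using card_Un_le[of "T \<inter> verts H" "T \<inter> S"] by simp
    qed
    moreover have "size N' = card (T \<inter> S)" by (simp add: N'_def)
    ultimately show "card T \<le> t" using 1 by linarith
  qed
  moreover have "\<alpha>\<^sub>G G \<ge> r"
    unfolding le_independence_number_iff[OF finG]
    using cS ES by (intro exI[of _ S]) (auto simp: VG indep_def)
  ultimately show ?thesis using sG arr by (simp add: \<H>_max_def in_\<H>_plus_iff)
qed

text \<open>The multiset to be found consists of the neighbourhoods of the vertices of
  \<open>S\<close>. A \<open>q - 1\<close>-clique in one of them would extend to a
  \<open>q\<close>-clique of \<open>G\<close>; common completions of non-edges give maximality and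
  condition (a); the bound on the independence number of \<open>G\<close> gives (b).\<close>

lemma step2_complete:
  assumes G: "G \<in> \<H>_max t as q n" and q: "q \<ge> 3"
    and S: "S \<subseteq> verts G" "indep S (edges G)" "card S = r"
    and HA: "delete_verts G S \<in> \<A>"
  shows "G \<in> step2 q r t \<A>"
proof -
  let ?H = "delete_verts G S"
  have sG: "simple_graph G" and qG: "cliques q G = {}" and pG: "plus_K q G" and aG: "\<alpha>\<^sub>G G \<le> t"
    using G by (simp_all add: \<H>_max_def in_\<H>_plus_iff)
  have fin: "finite (verts G)" "finite S" using sG S(1) finite_subset by (auto simp: simple_graph_def)
  define nb where "nb = (\<lambda>v. {u. {v, u} \<in> edges G})"
  define N where "N = image_mset nb (mset_set S)"
  have nbV: "nb v \<subseteq> verts G" for v using edge_in_simple_graph(2)[OF sG] by (auto simp: nb_def)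
  have nbS: "nb v \<inter> S = {}" if "v \<in> S" for v
  proof -
    have "u \<notin> S" if "u \<in> nb v" for u
      using that edge_in_simple_graph(3)[OF sG, of v u] indepD[OF S(2) \<open>v \<in> S\<close>, of u]
      by (auto simp: nb_def)
    then show ?thesis by blast
  qed
  have nb_self: "v \<notin> nb v" for v using edge_in_simple_graph(3)[OF sG, of v v] by (auto simp: nb_def)
  have Qnb: "Q \<subseteq> nb v" if "clique (insert v Q) (edges G)" "v \<notin> Q" for v Q
    using that by (auto simp: clique_insert_iff nb_def)
  have sub: "K \<in> cliques k (induced ?H X) \<longleftrightarrow> K \<in> cliques k G \<and> K \<inter> S = {} \<and> K \<subseteq> X" for K k X
    by (auto simp: cliques_induced in_cliques_delete_verts_iff)
  have "nb v \<in> max_K_free_sets (q - 1) ?H" if v: "v \<in> S" for v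
    unfolding max_K_free_sets_def
  proof (intro CollectI conjI allI impI)
    show "nb v \<subseteq> verts ?H" using nbV nbS[OF v] by auto
    show "\<not> contains_K (q - 1) (induced ?H (nb v))"
    proof
      assume "contains_K (q - 1) (induced ?H (nb v))"
      then obtain K where K: "K \<in> cliques (q - 1) G" "K \<subseteq> nb v" using sub by blast
      then have "v \<notin> K" using nb_self by blast
      moreover have "clique (insert v K) (edges G)"
        using K by (auto simp: clique_insert_iff in_cliques_iff nb_def)
      ultimately have "insert v K \<in> cliques q G" using K(1) v S(1) q by (auto simp: in_cliques_iff)
      with qG show False by blast
    qed
    \<comment> \<open>\<open>M\<close> contains a non-neighbour \<open>w\<close> of
      \<open>v\<close>. The common completion \<open>Q\<close> of \<open>v\<close> and
      \<open>w\<close> lies in \<open>nb v\<close>, so \<open>insert w Q\<close> is a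
      \<open>q - 1\<close>-clique inside \<open>M\<close>.\<close>
    fix M assume M: "nb v \<subset> M \<and> M \<subseteq> verts ?H"
    then obtain w where w: "w \<in> M" "w \<notin> nb v" "w \<in> verts G" "w \<notin> S" by auto
    then have "v \<noteq> w" "{v, w} \<notin> edges G" using v by (auto simp: nb_def)
    then obtain Q where Q: "Q \<subseteq> verts G" "finite Q" "v \<notin> Q" "w \<notin> Q" "card Q + 2 = q"
      "clique (insert v Q) (edges G)" "clique (insert w Q) (edges G)"
      using plus_KE[OF sG pG _ w(3)] v S(1) by blast
    have Qv: "Q \<subseteq> nb v" using Qnb[OF Q(6,3)] .
    then have "insert w Q \<inter> S = {}" "insert w Q \<subseteq> M" using nbS[OF v] w M by auto
    moreover have "insert w Q \<in> cliques (q - 1) G" using Q w(3) by (auto simp: in_cliques_iff)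
    ultimately show "contains_K (q - 1) (induced ?H M)" using sub by blast
  qed
  then have N1: "set_mset N \<subseteq> max_K_free_sets (q - 1) ?H" using fin(2) by (auto simp: N_def)
  have pair: "contains_K (q - 2) (induced ?H (nb u \<inter> nb v))" if uv: "u \<in> S" "v \<in> S" "u \<noteq> v" for u v
  proof -
    have "{u, v} \<notin> edges G" using uv by (rule indepD[OF S(2)])
    then obtain Q where Q: "Q \<subseteq> verts G" "finite Q" "u \<notin> Q" "v \<notin> Q" "card Q + 2 = q"
      "clique (insert u Q) (edges G)" "clique (insert v Q) (edges G)"
      using plus_KE[OF sG pG _ _ uv(3)] uv(1,2) S(1) by blast
    have "Q \<subseteq> nb u" "Q \<subseteq> nb v" using Qnb Q by blast+
    moreover have "clique Q (edges G)" using Q(6) by (rule clique_subset) blast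
    then have "Q \<in> cliques (q - 2) G" using Q(1,2,5) by (auto simp: in_cliques_iff)
    ultimately have "Q \<in> cliques (q - 2) (induced ?H (nb u \<inter> nb v))" using sub nbS[OF uv(1)] by blast
    then show ?thesis by blast
  qed
  \<comment> \<open>Two occurrences in \<open>N\<close> come from two different vertices of
    \<open>S\<close>, even when they are the same set.\<close>
  have N2: "contains_K (q - 2) (induced ?H (M\<^sub>1 \<inter> M\<^sub>2))" if sub2: "{#M\<^sub>1, M\<^sub>2#} \<subseteq># N" for M\<^sub>1 M\<^sub>2
  proof -
    obtain S' where S': "S' \<subseteq> S" "{#M\<^sub>1, M\<^sub>2#} = image_mset nb (mset_set S')"
      using subseteq_image_mset_setE[OF fin(2) sub2[unfolded N_def]] by blast
    have "card S' = 2" using arg_cong[OF S'(2), of size] by simp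
    then obtain u v where uv: "S' = {u, v}" "u \<noteq> v" by (auto simp: card_2_iff)
    then have "{#M\<^sub>1, M\<^sub>2#} = {#nb u, nb v#}" using S'(2) by simp
    then have "M\<^sub>1 = nb u \<and> M\<^sub>2 = nb v \<or> M\<^sub>1 = nb v \<and> M\<^sub>2 = nb u"
      by (auto simp: add_eq_conv_ex)
    with pair[of u v] pair[of v u] S'(1) uv show ?thesis by auto
  qed
  have N3: "\<alpha>\<^sub>G (delete_verts ?H (\<Union> (set_mset N'))) + size N' \<le> t" if sub2: "N' \<subseteq># N" for N'
  proof -
    obtain S' where S': "S' \<subseteq> S" "N' = image_mset nb (mset_set S')"
      using subseteq_image_mset_setE[OF fin(2) sub2[unfolded N_def]] by blast
    have fS': "finite S'" using S'(1) fin(2) by (rule finite_subset)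
    let ?D = "delete_verts ?H (\<Union> (set_mset N'))"
    have "finite (verts ?D)" using fin(1) by simp
    then obtain T where T: "T \<subseteq> verts ?D" "indep T (edges ?D)" "card T = \<alpha>\<^sub>G ?D"
      using le_independence_number_iff by blast
    have TV: "T \<inter> nb v = {}" if "v \<in> S'" for v
      using T(1) that fS' by (auto simp: S'(2))
    have TV': "T \<subseteq> verts G" "T \<inter> S = {}" using T(1) by auto
    have "indep T (edges ?H)" using indep_delete_verts_iff[of T ?H] T(1,2) by simp
    then have "indep T (edges G)" using indep_delete_verts_iff[of T G S] TV' by blast
    have "{v, u} \<notin> edges G \<and> {u, v} \<notin> edges G" if "v \<in> S'" "u \<in> T" for u v
      using TV[OF that(1)] that(2) by (auto simp: nb_def insert_commute)
    moreover have "indep S' (edges G)" using S(2) S'(1) by (auto simp: indep_def)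
    \<comment> \<open>An independent set that avoids the neighbourhoods of \<open>S'\<close> can be
      united with \<open>S'\<close>, which is where \<open>size N'\<close> enters condition
      (b).\<close>
    ultimately have "indep (T \<union> S') (edges G)"
      using \<open>indep T (edges G)\<close> unfolding indep_def by auto
    moreover have "T \<union> S' \<subseteq> verts G" using TV'(1) S'(1) S(1) by blast
    ultimately have "card (T \<union> S') \<le> t" using aG independence_number_le_iff[OF fin(1)] by blast
    moreover have "card (T \<union> S') = card T + card S'"
      using TV' S'(1) fS' fin(1) finite_subset[of T "verts G"] by (intro card_Un_disjoint) auto
    ultimately show ?thesis using T(3) S'(2) by simp
  qed
  have "size N = r" using S(3) by (simp add: N_def)
  with N1 N2 N3 have adm: "admissible q r t ?H N" unfolding admissible_def by blast
  let ?G = "(verts ?H \<union> S, edges ?H \<union> {{v, u} | v u. v \<in> S \<and> u \<in> nb v})"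
  have ext: "is_extension ?H N ?G"
    unfolding is_extension_iff using fin(2) N_def by (intro exI[of _ S] exI[of _ nb]) auto
  have NP: "set_mset N \<subseteq> Pow (verts ?H)" using N1 unfolding max_K_free_sets_def by blast
  \<comment> \<open>The vertices of \<open>S\<close> keep their names, so rebuilding yields
    \<open>G\<close> itself and not just a copy.\<close>
  have "?G = G"
  proof (rule simple_graph_eqI)
    show "simple_graph ?G"
      by (rule simple_graph_extension[OF simple_graph_delete_verts[OF sG] NP ext])
    show "verts ?G = verts G" using S(1) by auto
    fix u v
    have "{u, v} \<in> edges ?G \<longleftrightarrow> {u, v} \<in> edges ?H \<or> u \<in> S \<and> v \<in> nb u \<or> v \<in> S \<and> u \<in> nb v"
      by (auto simp: doubleton_eq_iff)
    then show "{u, v} \<in> edges ?G \<longleftrightarrow> {u, v} \<in> edges G"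
      unfolding edge_delete_verts[OF sG] nb_def by (auto simp: insert_commute)
  qed (rule sG)
  with ext have "is_extension ?H N G" by simp
  then show ?thesis
    unfolding step2_def using HA adm clique_number_add_edge[OF sG qG pG] by blast
qed

section \<open>Steps 5 and 6\<close>

text \<open>Since \<open>\<H>_max\<close> is closed under isomorphism, any set of representatives of
  it is a subset of it.\<close>

lemma coincide_\<H>_maxD:
  fixes \<A> :: "'v graph set" and G H :: "'v graph"
  assumes "\<A> \<approx>\<^sub>G (\<H>_max t as q n :: 'v graph set)"
  shows "G \<in> \<A> \<Longrightarrow> G \<in> \<H>_max t as q n"
    and "H \<in> \<H>_max t as q n \<Longrightarrow> \<exists>G\<in>\<A>. H \<cong>\<^sub>G G"
proof -
  assume "G \<in> \<A>"
  then obtain H :: "'v graph" where "H \<in> \<H>_max t as q n" "G \<cong>\<^sub>G H"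
    using assms unfolding coincide_def by blast
  then show "G \<in> \<H>_max t as q n"
    using \<H>_plus_iso[OF graph_iso_sym[of G H]] unfolding \<H>_max_def by blast
next
  assume "H \<in> \<H>_max t as q n"
  then obtain G where "G \<in> \<A>" "G \<cong>\<^sub>G H" using assms unfolding coincide_def by blast
  then show "\<exists>G\<in>\<A>. H \<cong>\<^sub>G G" using graph_iso_sym[of G H] by blast
qed

lemma card_verts_join_edgeless:
  assumes "simple_graph H" "finite S" "S \<inter> verts H = {}"
  shows "card (verts (graph_join (edgeless S) H)) = card S + card (verts H)"
  using assms card_Un_disjoint[of S "verts H"]
  by (simp add: verts_join_edgeless[OF assms] simple_graph_def)

text \<open>Most properties pass from \<open>K_1 + H\<close> through \<open>H\<close> to the larger
  join. The exception is \<open>plus_K\<close> for two vertices of \<open>S\<close>, which needs a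
  \<open>k - 1\<close>-clique in \<open>H\<close>, where \<open>q = Suc k\<close>; uniqueness of the
  cone vertex provides it.\<close>

lemma step5_sound:
  assumes "H1 \<in> \<H>_max t as' q (n - r)" "H1 = graph_join (edgeless {c}) H"
    and H: "simple_graph H" "c \<notin> verts H"
    and cone: "\<exists>!v. cone_vertex H1 v" and arr: "arrows H1 (a # as)"
    and a: "a \<ge> 2" "\<forall>b\<in>set as. b > 0"
    and S: "finite S" "card S = r + 1" "S \<inter> verts H = {}" and t: "t > r"
  shows "graph_join (edgeless S) H \<in> \<H>_max t (a # as) q n \<and> \<alpha>\<^sub>G (graph_join (edgeless S) H) \<ge> r"
proof -
  let ?G = "graph_join (edgeless S) H"
  have c: "finite {c}" "{c} \<inter> verts H = {}" "{c} \<noteq> {}" using H(2) by simp_all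
  have S0: "S \<noteq> {}" using S(2) by auto
  have h1: "card (verts H1) = n - r" "cliques q H1 = {}" "plus_K q H1" "\<alpha>\<^sub>G H1 \<le> t"
    using assms(1) by (simp_all add: \<H>_max_def in_\<H>_plus_iff)
  have "contains_K a H1" using arrows_contains_hd[OF arr a(2)] .
  then obtain K where K: "K \<subseteq> verts H1" "finite K" "card K = a" "clique K (edges H1)"
    unfolding contains_K_iff by blast
  have "a < q"
  proof (rule ccontr)
    assume "\<not> a < q"
    then have "contains_K q H1" using clique_of_smaller_size[OF K(1,4), of q] K(3) by simp
    with h1(2) show False by blast
  qed
  then obtain k where k: "q = Suc k" "k \<ge> 2" using a(1) by (cases q) auto
  have kH: "cliques k H = {}"
    using h1(2) contains_K_join_edgeless_iff[OF H(1) c, of k] unfolding assms(2) k(1) by blast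
  have pH: "plus_K k H"
    using plus_K_join_edgelessD[OF H(1) c kH] h1(3) unfolding assms(2) k(1) .
  have V1: "verts H1 = insert c (verts H)"
    unfolding assms(2) verts_join_edgeless[OF H(1) c(1,2)] by simp
  have cc: "cone_vertex H1 c"
    unfolding cone_vertex_def V1
    using edge_join_edgeless_cases(2)[OF H(1) c(1,2), of c] by (simp add: assms(2))
  have "contains_K (k - 1) H"
  proof -
    \<comment> \<open>A vertex \<open>u\<close> of \<open>H\<close> exists because \<open>K\<close>
      has at least two vertices. It is not a cone vertex of \<open>H1\<close>, so it lies on a
      non-edge of \<open>H\<close>, and the completion of that non-edge together with
      \<open>u\<close> has \<open>k - 1\<close> vertices.\<close>
    have "\<not> K \<subseteq> {c}" using K(2,3) a(1) card_mono[of "{c}" K] by auto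
    then obtain u where u: "u \<in> verts H" using K(1) V1 by blast
    then have "u \<noteq> c" using H(2) by blast
    then have "\<not> cone_vertex H1 u" using cone cc by blast
    then obtain v where v: "v \<in> verts H1" "v \<noteq> u" "{u, v} \<notin> edges H1"
      using u V1 unfolding cone_vertex_def by blast
    have "{u, c} \<in> edges H1"
      using edge_join_edgeless_cases(2)[OF H(1) c(1,2), of c u] u by (simp add: assms(2) insert_commute)
    then have "v \<in> verts H" using v V1 by auto
    moreover have "{u, v} \<notin> edges H"
      using v(3) edge_join_edgeless_cases(3)[OF H(1) c(1,2) u \<open>v \<in> verts H\<close>] by (simp add: assms(2))
    ultimately obtain Q where Q: "Q \<subseteq> verts H" "finite Q" "u \<notin> Q" "v \<notin> Q" "card Q + 2 = k"
      "clique (insert u Q) (edges H)" "clique (insert v Q) (edges H)"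
      using plus_KE[OF H(1) pH u _ v(2)[symmetric]] by metis
    then have "insert u Q \<in> cliques (k - 1) H" using u by (auto simp: in_cliques_iff)
    then show ?thesis by blast
  qed
  then have "plus_K q ?G"
    unfolding k(1) using k(2) by (intro plus_K_join_edgelessI[OF H(1) S(1,3) S0 pH]) simp_all
  moreover have "cliques q ?G = {}"
    using contains_K_join_edgeless_iff[OF H(1) S(1,3) S0, of k] kH unfolding k(1) by blast
  moreover have "arrows ?G (a # as)"
    using arrows_join_edgeless[OF H(1) c(1,2) S(1,3) S0] arr unfolding assms(2) .
  moreover have "card (verts ?G) = n"
  proof -
    \<comment> \<open>This makes \<open>n - r\<close> positive, so the counts add up to
      \<open>n\<close> without truncation.\<close>
    have "card (verts H1) = 1 + card (verts H)"
      using card_verts_join_edgeless[OF H(1) c(1,2)] by (simp add: assms(2))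
    then show ?thesis using card_verts_join_edgeless[OF H(1) S(1,3)] h1(1) S(2) by linarith
  qed
  moreover have "\<alpha>\<^sub>G ?G \<le> t"
    using independence_number_join_edgeless_le_iff[OF H(1) S(1,3), of t]
      independence_number_join_edgeless_le_iff[OF H(1) c(1,2), of t] h1(4) t S(2)
    by (simp add: assms(2))
  moreover have "r \<le> \<alpha>\<^sub>G ?G"
    using independence_number_join_edgeless_le_iff[OF H(1) S(1,3), of "\<alpha>\<^sub>G ?G"] S(2) by simp
  moreover have "simple_graph ?G" using H(1) S(1,3) by (rule simple_graph_join_edgeless)
  ultimately show ?thesis by (simp add: \<H>_max_def in_\<H>_plus_iff)
qed

text \<open>With a single added vertex there are no new non-edges, so \<open>plus_K\<close> lifts
  from \<open>H\<close> without a clique condition.\<close>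

lemma step6_sound:
  assumes "H \<in> \<H>_max t as' (q - 1) (n - 1)" "\<alpha>\<^sub>G H \<ge> r" "c \<notin> verts H"
    and arr: "arrows (graph_join (edgeless {c}) H) as"
    and pos: "q > 0" "n > 0" "t > 0"
  shows "graph_join (edgeless {c}) H \<in> \<H>_max t as q n \<and> \<alpha>\<^sub>G (graph_join (edgeless {c}) H) \<ge> r"
proof -
  let ?G = "graph_join (edgeless {c}) H"
  have c: "finite {c}" "{c} \<inter> verts H = {}" "{c} \<noteq> {}" using assms(3) by simp_all
  obtain k where k: "q = Suc k" using pos(1) by (cases q) auto
  have h: "simple_graph H" "card (verts H) = n - 1" "cliques k H = {}" "plus_K k H" "\<alpha>\<^sub>G H \<le> t"
    using assms(1) k by (simp_all add: \<H>_max_def in_\<H>_plus_iff)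
  \<comment> \<open>For \<open>k = 0\<close> the empty set would already be a forbidden clique of
    \<open>H\<close>.\<close>
  have "k > 0"
  proof (rule ccontr)
    assume "\<not> k > 0"
    then have "{} \<in> cliques k H" by (simp add: in_cliques_iff clique_def)
    with h(3) show False by blast
  qed
  then have "plus_K q ?G"
    unfolding k by (intro plus_K_join_edgelessI[OF h(1) c h(4)]) simp_all
  moreover have "cliques q ?G = {}"
    using contains_K_join_edgeless_iff[OF h(1) c, of k] h(3) unfolding k by blast
  moreover have "card (verts ?G) = n"
    using card_verts_join_edgeless[OF h(1) c(1,2)] h(2) pos(2) by simp
  moreover have "\<alpha>\<^sub>G ?G \<le> t"
    using independence_number_join_edgeless_le_iff[OF h(1) c(1,2), of t] h(5) pos(3) by simp
  moreover have "r \<le> \<alpha>\<^sub>G ?G"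
    using independence_number_join_edgeless_le_iff[OF h(1) c(1,2), of "\<alpha>\<^sub>G ?G"] assms(2) by simp
  moreover have "simple_graph ?G" using h(1) c(1,2) by (rule simple_graph_join_edgeless)
  ultimately show ?thesis using arr by (simp add: \<H>_max_def in_\<H>_plus_iff)
qed

text \<open>Deleting the cone vertex lowers \<open>q\<close>, \<open>n\<close> and, since
  \<open>{c}\<close> is independent, also the first entry of the arrow list by one. The copy of the
  rest found in \<open>\<A>\<close> is joined to a fresh vertex again.\<close>

lemma step6_complete:
  fixes G :: "nat graph" and \<A> :: "nat graph set"
  assumes G: "G \<in> \<H>_max t (a # as) q n" and q: "q \<ge> 3" and cone: "cone_vertex G c"
    and alpha: "\<alpha>\<^sub>G G \<ge> r" and ne: "verts G \<noteq> {c}"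
    and \<A>: "\<A> \<approx>\<^sub>G (\<H>_max t ((a - 1) # as) (q - 1) (n - 1) :: nat graph set)"
  shows "\<exists>G' \<in> step6 (a # as) r \<A>. G \<cong>\<^sub>G G'"
proof -
  have sG: "simple_graph G" and cG: "card (verts G) = n" and arr: "arrows G (a # as)"
    and qG: "cliques q G = {}" and pG: "plus_K q G" and aG: "\<alpha>\<^sub>G G \<le> t"
    using G by (simp_all add: \<H>_max_def in_\<H>_plus_iff)
  define H where "H = delete_verts G {c}"
  have cV: "c \<in> verts G" using cone by (simp add: cone_vertex_def)
  have sH: "simple_graph H" unfolding H_def using sG by (rule simple_graph_delete_verts)
  have c: "finite {c}" "{c} \<inter> verts H = {}" "{c} \<noteq> {}" by (auto simp: H_def)
  have GH: "graph_join (edgeless {c}) H = G" unfolding H_def using sG cone by (rule cone_vertex_join)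
  have fin: "finite (verts G)" "finite (verts H)" using sG sH by (simp_all add: simple_graph_def)
  obtain k where k: "q = Suc k" using q by (cases q) auto
  have kH: "cliques k H = {}"
    using contains_K_join_edgeless_iff[OF sH c, of k] qG unfolding k GH by blast
  have "plus_K k H" using plus_K_join_edgelessD[OF sH c kH] pG unfolding k GH .
  moreover have "card (verts H) = n - 1" using cV cG fin by (simp add: H_def)
  moreover have "arrows H ((a - 1) # as)"
    unfolding H_def by (rule arrows_delete_indep[OF _ arr]) (simp add: indep_def)
  moreover have "\<alpha>\<^sub>G H \<le> t" unfolding H_def using sG aG by (rule independence_number_delete_verts_le)
  ultimately have "H \<in> \<H>_max t ((a - 1) # as) (q - 1) (n - 1)"
    using sH kH k by (simp add: \<H>_max_def in_\<H>_plus_iff)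
  then obtain X where X: "X \<in> \<A>" "H \<cong>\<^sub>G X" using coincide_\<H>_maxD(2)[OF \<A>] by blast
  \<comment> \<open>The cone vertex contributes only independent sets of size one, and
    \<open>H\<close> is nonempty, so its deletion does not lower the independence number.\<close>
  have "r \<le> \<alpha>\<^sub>G H"
  proof -
    obtain v where "v \<in> verts H" using ne cV by (auto simp: H_def)
    then have "1 \<le> \<alpha>\<^sub>G H"
      unfolding le_independence_number_iff[OF fin(2)] by (intro exI[of _ "{v}"]) (simp add: indep_def)
    then have "\<alpha>\<^sub>G G \<le> \<alpha>\<^sub>G H"
      using independence_number_join_edgeless_le_iff[OF sH c(1,2), of "\<alpha>\<^sub>G H"] GH by simp
    with alpha show ?thesis by simp
  qed
  then have "r \<le> \<alpha>\<^sub>G X" using independence_number_iso[OF X(2)] by simp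
  have sX: "simple_graph X" using X(2) by (simp add: graph_iso_iff)
  then obtain d where d: "d \<notin> verts X"
    using ex_new_if_finite[OF infinite_UNIV_nat] by (auto simp: simple_graph_def)
  have iso: "G \<cong>\<^sub>G graph_join (edgeless {d}) X"
    using graph_join_edgeless_iso[OF X(2) c(1,2), of "{d}"] d unfolding GH by simp
  then have "arrows (graph_join (edgeless {d}) X) (a # as)" using arr by (rule arrows_iso)
  then have "graph_join (edgeless {d}) X \<in> step6 (a # as) r \<A>"
    unfolding step6_def using X(1) \<open>r \<le> \<alpha>\<^sub>G X\<close> d by blast
  with iso show ?thesis by blast
qed

text \<open>If \<open>G\<close> itself has no cone vertex, then a cone vertex \<open>c\<close> of \<open>G - S\<close> has a non-neighbour in
  \<open>S\<close>; maximality then forces all of \<open>S\<close> to be twins of \<open>c\<close>.\<close>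

lemma cone_of_rest_twins:
  assumes sG: "simple_graph G" and qG: "cliques q G = {}" and pG: "plus_K q G"
    and S: "S \<subseteq> verts G" "indep S (edges G)"
    and nocone: "\<not> cone_vertex G c" and cone: "cone_vertex (delete_verts G S) c"
    and s: "s \<in> insert c S" and v: "v \<in> verts G"
  shows "{s, v} \<in> edges G \<longleftrightarrow> v \<notin> insert c S"
proof -
  have c: "c \<in> verts G" "c \<notin> S" using cone by (auto simp: cone_vertex_def)
  have cadj: "{c, x} \<in> edges G" if "x \<in> verts G" "x \<notin> S" "x \<noteq> c" for x
    using cone that by (auto simp: cone_vertex_def edge_delete_verts[OF sG])
  have noK: "\<not> clique K (edges G)" if "K \<subseteq> verts G" "finite K" "card K = q" for K
    using qG that by (auto simp: in_cliques_iff)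
  have nonadj: "x \<notin> S" if "clique (insert s Q) (edges G)" "s \<notin> Q" "s \<in> S" "x \<in> Q" for s Q x
    using that clique_indep_eq[OF that(1) S(2), of s x] by auto
  \<comment> \<open>\<open>c\<close> is adjacent to everything else outside \<open>S\<close>, so its
    non-neighbour must lie in \<open>S\<close>.\<close>
  obtain s0 where s0: "s0 \<in> S" "{c, s0} \<notin> edges G"
    using nocone c cadj unfolding cone_vertex_def by blast
  have 1: "{c, s} \<notin> edges G" if s: "s \<in> S" for s
  proof (cases "s = s0")
    case False
    have "{s0, s} \<notin> edges G" using indepD[OF S(2) s0(1) s] False by blast
    then obtain Q where Q: "Q \<subseteq> verts G" "finite Q" "s0 \<notin> Q" "s \<notin> Q" "card Q + 2 = q"
      "clique (insert s0 Q) (edges G)" "clique (insert s Q) (edges G)"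
      using plus_KE[OF sG pG _ _ False[symmetric]] s0(1) s S(1) by blast
    show ?thesis
    proof
      assume e: "{c, s} \<in> edges G"
      have "c \<notin> Q"
        using cliqueD[OF Q(6), of c s0] s0 c by auto
      moreover have "{c, x} \<in> edges G" if "x \<in> insert s Q" for x
      proof (cases "x = s")
        case False
        with that have "x \<in> Q" by blast
        then show ?thesis using cadj nonadj[OF Q(7,4) s] Q(1) \<open>c \<notin> Q\<close> by blast
      qed (simp add: e)
      \<comment> \<open>\<open>Q\<close> avoids \<open>S\<close> because it is adjacent to
        \<open>s\<close>, so \<open>c\<close> is adjacent to all of it; with \<open>s\<close> and
        \<open>c\<close> it would become a \<open>q\<close>-clique.\<close>
      ultimately have "clique (insert c (insert s Q)) (edges G)"
        using Q(7) unfolding clique_insert_iff[of c] by blast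
      moreover have "c \<noteq> s" using c s by blast
      then have "card (insert c (insert s Q)) = q" using \<open>c \<notin> Q\<close> Q(2,4,5) by simp
      ultimately show False using noK[of "insert c (insert s Q)"] Q(1,2) c(1) s S(1) by auto
    qed
  qed (simp add: s0)
  \<comment> \<open>The common completion of \<open>s\<close> and \<open>x\<close> avoids
    \<open>S\<close>, and it avoids \<open>c\<close> by the previous fact. Adding \<open>c\<close>
    and \<open>x\<close> to it would give a \<open>q\<close>-clique.\<close>
  have 2: "{s, x} \<in> edges G" if s: "s \<in> S" and x: "x \<in> verts G" "x \<notin> S" "x \<noteq> c" for s x
  proof (rule ccontr)
    assume e: "{s, x} \<notin> edges G"
    have "s \<noteq> x" using s x(2) by blast
    then obtain Q where Q: "Q \<subseteq> verts G" "finite Q" "s \<notin> Q" "x \<notin> Q" "card Q + 2 = q"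
      "clique (insert s Q) (edges G)" "clique (insert x Q) (edges G)"
      using plus_KE[OF sG pG _ x(1) _ e] s S(1) by blast
    have "c \<notin> Q" using cliqueD[OF Q(6), of c s] 1[OF s] s c by auto
    moreover have "{c, y} \<in> edges G" if "y \<in> insert x Q" for y
      using that cadj x nonadj[OF Q(6,3) s] Q(1) \<open>c \<notin> Q\<close> by blast
    ultimately have "clique (insert c (insert x Q)) (edges G)"
      using Q(7) unfolding clique_insert_iff[of c] by blast
    moreover have "card (insert c (insert x Q)) = q" using \<open>c \<notin> Q\<close> x(3) Q(2,4,5) by simp
    ultimately show False using noK[of "insert c (insert x Q)"] Q(1,2) c(1) x(1) by auto
  qed
  have 3: "{s, c} \<notin> edges G" if "s \<in> S" for s using 1[OF that] by (simp add: insert_commute)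
  have 4: "{s, v} \<notin> edges G" if "s \<in> S" "v \<in> S" for s v
    using indepD[OF S(2) that] edge_in_simple_graph(3)[OF sG, of s v] by blast
  show ?thesis
  proof (cases "s = c")
    case True
    then show ?thesis
      using cadj[OF v] 1[of v] edge_in_simple_graph(3)[OF sG, of c c] by auto
  next
    case False
    with s have "s \<in> S" by blast
    then show ?thesis using 2[OF _ v] 3 4 by auto
  qed
qed

text \<open>Both \<open>G\<close> and \<open>H = G - S\<close> are joins over the same graph
  \<open>D\<close>: with the edgeless graph on the twins \<open>?T\<close>, and with the single
  vertex \<open>c\<close>. Hence \<open>H\<close> is maximal too, and the copy \<open>X\<close> of
  it in \<open>\<A>\<close> is the one from which step 5 rebuilds \<open>G\<close>.\<close>

lemma step5_complete:
  fixes G :: "nat graph" and \<A> :: "nat graph set"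
  assumes G: "G \<in> \<H>_max t (a # as) q n" and q: "q \<ge> 3"
    and S: "S \<subseteq> verts G" "indep S (edges G)" "card S = r"
    and nocone: "\<nexists>v. cone_vertex G v" and cone: "cone_vertex (delete_verts G S) c"
    and \<A>: "\<A> \<approx>\<^sub>G (\<H>_max t ((a - 1) # as) q (n - r) :: nat graph set)"
  shows "\<exists>G' \<in> step5 (a # as) r t \<A>. G \<cong>\<^sub>G G'"
proof -
  have sG: "simple_graph G" and cG: "card (verts G) = n" and arr: "arrows G (a # as)"
    and qG: "cliques q G = {}" and pG: "plus_K q G" and aG: "\<alpha>\<^sub>G G \<le> t"
    using G by (simp_all add: \<H>_max_def in_\<H>_plus_iff)
  define H where "H = delete_verts G S"
  define D where "D = delete_verts G (insert c S)"
  let ?T = "insert c S"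
  have fin: "finite (verts G)" "finite S" using sG S(1) finite_subset by (auto simp: simple_graph_def)
  have c: "c \<in> verts G" "c \<notin> S" using cone by (auto simp: cone_vertex_def)
  have sH: "simple_graph H" and sD: "simple_graph D"
    unfolding H_def D_def using sG by (simp_all add: simple_graph_delete_verts)
  have tw: "{s, v} \<in> edges G \<longleftrightarrow> v \<notin> ?T" if "s \<in> ?T" "v \<in> verts G" for s v
    using cone_of_rest_twins[OF sG qG pG S(1,2) _ cone that] nocone by blast
  have GD: "graph_join (edgeless ?T) D = G"
    unfolding D_def by (rule delete_verts_join_edgeless[OF sG]) (use S(1) c tw in auto)
  have DH: "delete_verts H {c} = D"
    unfolding H_def D_def delete_verts_delete_verts[OF sG] by simp
  have HD: "graph_join (edgeless {c}) D = H"
    using cone_vertex_join[OF sH, of c] cone unfolding DH by (simp add: H_def)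
  have T: "finite ?T" "?T \<inter> verts D = {}" "?T \<noteq> {}" using fin(2) by (auto simp: D_def)
  have C: "finite {c}" "{c} \<inter> verts D = {}" "{c} \<noteq> {}" by (auto simp: D_def)
  obtain k where k: "q = Suc k" "k > 0" using q by (cases q) auto
  have kD: "cliques k D = {}"
    using contains_K_join_edgeless_iff[OF sD T, of k] qG unfolding k GD by blast
  \<comment> \<open>Maximality descends from \<open>G\<close> to \<open>D\<close> and then lifts to
    \<open>H\<close>, where only the one vertex \<open>c\<close> is added.\<close>
  have "plus_K k D" using plus_K_join_edgelessD[OF sD T kD] pG unfolding k GD .
  then have "plus_K q H"
    unfolding k HD[symmetric] by (intro plus_K_join_edgelessI[OF sD C]) (use k in simp_all)
  moreover have "cliques q H = {}"
    using contains_K_join_edgeless_iff[OF sD C, of k] kD unfolding k HD by blast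
  moreover have "card (verts H) = n - r"
    using S cG fin by (simp add: H_def card_Diff_subset)
  moreover have "arrows H ((a - 1) # as)" unfolding H_def by (rule arrows_delete_indep[OF S(2) arr])
  moreover have "\<alpha>\<^sub>G H \<le> t" unfolding H_def using sG aG by (rule independence_number_delete_verts_le)
  ultimately have "H \<in> \<H>_max t ((a - 1) # as) q (n - r)"
    using sH by (simp add: \<H>_max_def in_\<H>_plus_iff)
  then obtain X where X: "X \<in> \<A>" "H \<cong>\<^sub>G X" using coincide_\<H>_maxD(2)[OF \<A>] by blast
  then obtain f where f: "iso_map f H X" and sX: "simple_graph X" by (auto simp: graph_iso_iff)
  have cH: "cone_vertex H c" "c \<in> verts H" using cone by (simp_all add: H_def cone_vertex_def)
  \<comment> \<open>A second cone vertex of \<open>H\<close> would be adjacent to all of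
    \<open>S\<close> by the twin property, hence a cone vertex of \<open>G\<close>.\<close>
  have uniq: "v = c" if v: "cone_vertex H v" for v
  proof (rule ccontr)
    assume "v \<noteq> c"
    with v have vG: "v \<in> verts G" "v \<notin> ?T" by (auto simp: cone_vertex_def H_def)
    have "{v, u} \<in> edges G" if "u \<in> verts G - {v}" for u
    proof (cases "u \<in> S")
      case True
      then show ?thesis using tw[of u v] vG by (simp add: insert_commute)
    next
      case False
      with that have "u \<in> verts H - {v}" by (simp add: H_def)
      with v have "{v, u} \<in> edges H" unfolding cone_vertex_def by blast
      then show ?thesis by (simp add: H_def edge_delete_verts[OF sG])
    qed
    with vG(1) nocone show False unfolding cone_vertex_def by blast
  qed
  define E where "E = delete_verts X {f c}"
  have cX: "cone_vertex X (f c)" using cone_vertex_image[OF f cH(2)] cH(1) by simp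
  have XE: "graph_join (edgeless {f c}) E = X" unfolding E_def using sX cX by (rule cone_vertex_join)
  have uX: "\<exists>!v. cone_vertex X v"
  proof (rule ex1I[of _ "f c"])
    fix y assume y: "cone_vertex X y"
    then have "y \<in> verts X" by (simp add: cone_vertex_def)
    then obtain v where v: "v \<in> verts H" "y = f v" using iso_mapD(2)[OF f] by blast
    with y cone_vertex_image[OF f v(1)] uniq show "y = f c" by blast
  qed (rule cX)
  \<comment> \<open>Step 5 tests the original list; collapsing the twins \<open>?T\<close> to the
    single vertex \<open>c\<close> preserves the arrow relation.\<close>
  have arrX: "arrows X (a # as)"
  proof (rule arrows_iso[OF X(2)])
    show "arrows H (a # as)"
      using arrows_join_edgeless[OF sD T(1,2) C] arr unfolding GD HD .
  qed
  have sE: "simple_graph E" unfolding E_def using sX by (rule simple_graph_delete_verts)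
  have DE: "D \<cong>\<^sub>G E" using delete_vert_iso[OF f sH sX cH(2)] unfolding DH E_def .
  \<comment> \<open>\<open>?T\<close> is independent in \<open>G\<close> and has
    \<open>r + 1\<close> elements, so the guard \<open>t > r\<close> of step 5 holds.\<close>
  have "card ?T \<le> t"
    using independence_number_join_edgeless_le_iff[OF sD T(1,2), of t] aG unfolding GD by blast
  then have t: "t > r" using c(2) fin(2) S(3) by simp
  \<comment> \<open>Vertices are natural numbers, so fresh names for the \<open>r + 1\<close> twins
    exist.\<close>
  have "infinite (- verts E)"
    using sE infinite_UNIV_nat by (simp add: simple_graph_def finite_compl)
  then obtain S' where S': "S' \<subseteq> - verts E" "finite S'" "card S' = r + 1"
    by (meson infinite_arbitrarily_large)
  have iso: "G \<cong>\<^sub>G graph_join (edgeless S') E"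
    using graph_join_edgeless_iso[OF DE T(1,2), of S'] S' c(2) fin(2) S(3) unfolding GD by auto
  have "S' \<inter> verts E = {}" using S'(1) by blast
  moreover have "f c \<notin> verts E" by (simp add: E_def)
  ultimately have "graph_join (edgeless S') E \<in> step5 (a # as) r t \<A>"
    unfolding step5_def if_P[OF t] using sE S'(2,3) X(1) uX arrX
    by (intro CollectI exI[of _ S'] exI[of _ E] conjI exI[of _ "f c"]) (simp_all only: XE not_False_eq_True)
  with iso show ?thesis by blast
qed

section \<open>The output of the algorithm\<close>

theorem theorem3p10:
  fixes a\<^sub>1 q n r t :: nat and as :: "nat list" and \<A>\<^sub>1 \<A>\<^sub>2 \<B> :: "nat graph set"
  assumes "a\<^sub>1 \<ge> 2" and "\<forall>a \<in> set as. a > 0"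
    and "q > 0" and "n > 0" and "r > 0" and "t > 0"
    and "\<A>\<^sub>1 \<approx>\<^sub>G (\<H>_max t ((a\<^sub>1 - 1) # as) q (n - r) :: nat graph set)"
    and "\<A>\<^sub>2 \<approx>\<^sub>G (\<H>_max t ((a\<^sub>1 - 1) # as) (q - 1) (n - 1) :: nat graph set)"
    and "algorithm_B (a\<^sub>1 # as) q n r t \<A>\<^sub>1 \<A>\<^sub>2 \<B>"
  shows "(\<forall>H \<in> (step1 (a\<^sub>1 # as) q n r t :: nat graph set).
            \<exists>G \<in> \<A>\<^sub>1. obtained_by_removing_edges H G) \<and>
         \<B> \<approx>\<^sub>G {G :: nat graph. G \<in> \<H>_max t (a\<^sub>1 # as) q n \<and> \<alpha>\<^sub>G G \<ge> r}"
proof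
  have step1_iff: "H \<in> step1 (a\<^sub>1 # as) q n r t \<longleftrightarrow>
      H \<in> \<H>_plus t (q - 1) ((a\<^sub>1 - 1) # as) q (n - r) \<and> (\<nexists>v. cone_vertex H v)" for H :: "nat graph"
    by (simp add: step1_def)
  then show "\<forall>H \<in> (step1 (a\<^sub>1 # as) q n r t :: nat graph set).
      \<exists>G \<in> \<A>\<^sub>1. obtained_by_removing_edges H G"
    using obtained_from_maximal[OF assms(7)] by blast
  let ?T = "{G :: nat graph. G \<in> \<H>_max t (a\<^sub>1 # as) q n \<and> \<alpha>\<^sub>G G \<ge> r}"
  obtain \<B>\<^sub>3 where B3: "step3 (step2 q r t (step1 (a\<^sub>1 # as) q n r t)) \<B>\<^sub>3"
    and B: "\<B> = step4 (a\<^sub>1 # as) \<B>\<^sub>3 \<union> step5 (a\<^sub>1 # as) r t \<A>\<^sub>1 \<union> step6 (a\<^sub>1 # as) r \<A>\<^sub>2"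
    using assms(9) unfolding algorithm_B_def by blast
  have "G \<in> ?T" if "G \<in> step4 (a\<^sub>1 # as) \<B>\<^sub>3" for G
  proof -
    have arr: "arrows G (a\<^sub>1 # as)" and "G \<in> step2 q r t (step1 (a\<^sub>1 # as) q n r t)"
      using that B3 unfolding step3_def step4_def by blast+
    then obtain H N where H: "H \<in> step1 (a\<^sub>1 # as) q n r t" "admissible q r t H N"
      "is_extension H N G" "\<forall>e \<in> complement_edges G. \<omega>\<^sub>G (add_edge G e) = q"
      unfolding step2_def by blast
    from H(1) have H1: "H \<in> \<H>_plus t (q - 1) ((a\<^sub>1 - 1) # as) q (n - r)"
      unfolding step1_iff by blast
    then have HH: "arrows H ((a\<^sub>1 - 1) # as)" "card (verts H) = n - r" "finite (verts H)"
      by (simp_all add: in_\<H>_plus_iff simple_graph_def)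
    have "verts H \<noteq> {}" by (rule arrows_verts_nonempty[OF HH(1)]) (use assms(1,2) in auto)
    then have "n - r > 0" using HH(2,3) by (metis card_gt_0_iff)
    then have "n \<ge> r" by simp
    from step2_sound[OF H1 this H(2-4) arr] show ?thesis by simp
  qed
  moreover have "G \<in> ?T" if G: "G \<in> step5 (a\<^sub>1 # as) r t \<A>\<^sub>1" for G
  proof (cases "t > r")
    case True
    from G obtain S H c where *: "G = graph_join (edgeless S) H" "simple_graph H" "finite S"
      "card S = r + 1" "S \<inter> verts H = {}" "c \<notin> verts H" "graph_join (edgeless {c}) H \<in> \<A>\<^sub>1"
      "\<exists>!v. cone_vertex (graph_join (edgeless {c}) H) v"
      "arrows (graph_join (edgeless {c}) H) (a\<^sub>1 # as)"
      unfolding step5_def if_P[OF True] by blast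
    from step5_sound[OF coincide_\<H>_maxD(1)[OF assms(7) *(7)] refl *(2,6,8,9) assms(1,2) *(3,4,5) True]
    show ?thesis using *(1) by simp
  next
    case False
    with G show ?thesis by (simp add: step5_def)
  qed
  moreover have "G \<in> ?T" if "G \<in> step6 (a\<^sub>1 # as) r \<A>\<^sub>2" for G
  proof -
    from that obtain c H where *: "G = graph_join (edgeless {c}) H" "H \<in> \<A>\<^sub>2" "\<alpha>\<^sub>G H \<ge> r"
      "c \<notin> verts H" "arrows (graph_join (edgeless {c}) H) (a\<^sub>1 # as)"
      unfolding step6_def by blast
    from step6_sound[OF coincide_\<H>_maxD(1)[OF assms(8) *(2)] *(3,4,5) assms(3,4,6)]
    show ?thesis using *(1) by simp
  qed
  \<comment> \<open>Soundness is a literal inclusion; only completeness needs isomorphic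
    copies.\<close>
  ultimately have sound: "\<B> \<subseteq> ?T" unfolding B by blast
  have complete: "\<exists>G'\<in>\<B>. G \<cong>\<^sub>G G'" if "G \<in> ?T" for G
  proof -
    have G: "G \<in> \<H>_max t (a\<^sub>1 # as) q n" and alpha: "\<alpha>\<^sub>G G \<ge> r" using that by simp_all
    then have sG: "simple_graph G" and cG: "card (verts G) = n" and arr: "arrows G (a\<^sub>1 # as)"
      and qG: "cliques q G = {}" and pG: "plus_K q G" and aG: "\<alpha>\<^sub>G G \<le> t"
      by (simp_all add: \<H>_max_def in_\<H>_plus_iff)
    have fin: "finite (verts G)" using sG by (simp add: simple_graph_def)
    obtain K where K: "K \<subseteq> verts G" "finite K" "card K = a\<^sub>1" "clique K (edges G)"
      using arrows_contains_hd[OF arr assms(2)] unfolding contains_K_iff by blast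
    have q: "q \<ge> 3"
    proof (rule ccontr)
      assume "\<not> q \<ge> 3"
      then have "contains_K q G" using clique_of_smaller_size[OF K(1,4), of q] K(3) assms(1) by simp
      with qG show False by blast
    qed
    obtain S where S: "S \<subseteq> verts G" "indep S (edges G)" "card S = r"
      using alpha le_independence_number_iff[OF fin] by blast
    show ?thesis
    proof (cases "\<exists>v. cone_vertex G v")
      case True
      then obtain c where c: "cone_vertex G c" by blast
      \<comment> \<open>\<open>K\<close> has \<open>a\<^sub>1 \<ge> 2\<close> vertices.\<close>
      have "verts G \<noteq> {c}" using K(1,3) assms(1) card_mono[OF fin K(1)] by auto
      from step6_complete[OF G q c alpha this assms(8)] show ?thesis unfolding B by blast
    next
      case nocone: False
      show ?thesis
      proof (cases "\<exists>v. cone_vertex (delete_verts G S) v")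
        case True
        then obtain c where c: "cone_vertex (delete_verts G S) c" by blast
        from step5_complete[OF G q S nocone c assms(7)] show ?thesis unfolding B by blast
      next
        case False
        have "cliques q (delete_verts G S) = {}"
          using qG in_cliques_delete_verts_iff[of _ q G S] by blast
        moreover have "card (verts (delete_verts G S)) = n - r"
          using S cG finite_subset[OF S(1) fin] by (simp add: card_Diff_subset)
        ultimately have "delete_verts G S \<in> step1 (a\<^sub>1 # as) q n r t"
          unfolding step1_iff in_\<H>_plus_iff
          using False simple_graph_delete_verts[OF sG] arrows_delete_indep[OF S(2) arr]
            plus_K_delete_indep[OF sG pG q S(2)] independence_number_delete_verts_le[OF sG aG] by blast
        then have "G \<in> step2 q r t (step1 (a\<^sub>1 # as) q n r t)" by (rule step2_complete[OF G q S])
        \<comment> \<open>Step 3 may have kept another representative of the class of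
          \<open>G\<close>; it survives step 4 because the arrow relation is invariant.\<close>
        then obtain G' where G': "G' \<in> \<B>\<^sub>3" "G \<cong>\<^sub>G G'" using B3 unfolding step3_def by blast
        have "G' \<in> step4 (a\<^sub>1 # as) \<B>\<^sub>3"
          unfolding step4_def using G'(1) arrows_iso[OF G'(2) arr] by blast
        with G'(2) show ?thesis unfolding B by blast
      qed
    qed
  qed
  show "\<B> \<approx>\<^sub>G ?T"
    unfolding coincide_def
  proof (intro conjI ballI)
    fix G assume "G \<in> \<B>"
    then have "G \<in> ?T" using sound by blast
    moreover from this have "G \<cong>\<^sub>G G" by (intro graph_iso_refl) (simp add: \<H>_max_def in_\<H>_plus_iff)
    ultimately show "\<exists>H\<in>?T. G \<cong>\<^sub>G H" by blast
  next
    fix H assume "H \<in> ?T"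
    then obtain G' where "G' \<in> \<B>" "H \<cong>\<^sub>G G'" using complete by blast
    then show "\<exists>G\<in>\<B>. G \<cong>\<^sub>G H" using graph_iso_sym[of H G'] by blast
  qed
qed

end
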